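(* Let $\Omega\subset\mathbb{R}^N$ be a convex compact set and let $f\in\mathbf{X}_0(\Omega)$. Then there exists a measure $\sigma$ of minimal total variation $\|\sigma\|$ among all positive finite measures $\sigma\in\mathcal{M}^+(\Omega\times S^{N-1}\times[0,\infty))$ satisfying $$\int_{\Omega\times S^{N-1}\times[0,\infty)}D_\varphi(x,v,t)\,d\sigma=\langle f,\varphi\rangle\qquad\forall\varphi\in\mathcal{C}^1_0(\mathbb{R}^N).$$ Moreover this minimal value coincides with $$\mathcal{W}^1(f)=\sup\{\langle f,u\rangle: u\in\mathcal{C}^1_0(\mathbb{R}^N),\ \|\nabla u\|_\infty\le1\}.$$
   Context: $\Omega$ is a convex compact subset of $\mathbb{R}^N$, and $S^{N-1}$ is the unit sphere of $\mathbb{R}^N$. $\mathbf{X}_0(\Omega)$ is the space of distributions $f\in\mathcal{D}'(\mathbb{R}^N)$ for which there is a constant $C$ with $\langle f,\varphi\rangle\le C(\|\varphi\|_{L^\infty(\Omega)}+\|\nabla\varphi\|_{L^\infty(\Omega)})$ for all $\varphi\in\mathcal{D}(\mathbb{R}^N)$ (smooth, compactly supported), and such that $\langle f,1\rangle=0$, meaning that $\langle f,\varphi\rangle=0$ whenever $\varphi\in\mathcal{D}(\mathbb{R}^N)$ is constant on $\Omega$. Such $f$ extends to $\mathcal{C}^1_0(\mathbb{R}^N)$, the compactly supported $\mathcal{C}^1$ functions. For $\varphi\in\mathcal{C}^1_0(\mathbb{R}^N)$, the function $D_\varphi$ on $\Omega\times S^{N-1}\times[0,\infty)$ is $$D_\varphi(x,v,t)=\frac{\varphi(x+tv)-\varphi(x)}{t}\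 \text{ if } t\ne0,\qquad D_\varphi(x,v,0)=D\varphi(x)\cdot v.$$ *)

theory Defs
  imports "HOL-Analysis.Analysis"
begin

definition gradient :: "(real^'n \<Rightarrow> real) \<Rightarrow> real^'n \<Rightarrow> real^'n" where
  "gradient \<phi> x = (\<chi> i. frechet_derivative \<phi> (at x) (axis i 1))"

fun iterated_partial :: "'n list \<Rightarrow> (real^'n \<Rightarrow> real) \<Rightarrow> real^'n \<Rightarrow> real" where
  "iterated_partial [] \<phi> = \<phi>"
| "iterated_partial (i # is) \<phi> =
     (\<lambda>x. frechet_derivative (iterated_partial is \<phi>) (at x) (axis i 1))"

text \<open>Differentiability of every iterated partial derivative makes all of them continuous,
  so this is the class of infinitely differentiable functions.\<close>

definition smooth :: "(real^'n \<Rightarrow> real) \<Rightarrow> bool" where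
  "smooth \<phi> \<longleftrightarrow> (\<forall>is x. iterated_partial is \<phi> differentiable (at x))"

definition supp :: "(real^'n \<Rightarrow> real) \<Rightarrow> (real^'n) set" where
  "supp \<phi> = closure {x. \<phi> x \<noteq> 0}"

definition test_functions :: "(real^'n \<Rightarrow> real) set" where
  "test_functions = {\<phi>. smooth \<phi> \<and> compact (supp \<phi>)}"

definition C1_compact :: "(real^'n \<Rightarrow> real) set" where
  "C1_compact = {\<phi>. (\<forall>x. \<phi> differentiable (at x)) \<and> continuous_on UNIV (gradient \<phi>)
                    \<and> compact (supp \<phi>)}"

definition sup_norm_on :: "(real^'n) set \<Rightarrow> (real^'n \<Rightarrow> 'b::real_normed_vector) \<Rightarrow> real" where
  "sup_norm_on S g = (SUP x\<in>S. norm (g x))"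

text \<open>A distribution is a function on all of \<^typ>\<open>real^'n \<Rightarrow> real\<close> of which only the values
  on test functions matter.\<close>

definition distribution :: "((real^'n \<Rightarrow> real) \<Rightarrow> real) \<Rightarrow> bool" where
  "distribution f \<longleftrightarrow>
     (\<forall>\<phi>\<in>test_functions. \<forall>\<psi>\<in>test_functions. f (\<lambda>x. \<phi> x + \<psi> x) = f \<phi> + f \<psi>) \<and>
     (\<forall>c. \<forall>\<phi>\<in>test_functions. f (\<lambda>x. c * \<phi> x) = c * f \<phi>) \<and>
     (\<forall>K. compact K \<longrightarrow> (\<exists>C m. \<forall>\<phi>\<in>test_functions. supp \<phi> \<subseteq> K \<longrightarrow>
        \<bar>f \<phi>\<bar> \<le> C * (\<Sum>is\<in>{is. length is \<le> m}. sup_norm_on UNIV (iterated_partial is \<phi>))))"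

text \<open>The norms over \<open>\<Omega>\<close> are suprema over all points of \<open>\<Omega>\<close>, not essential suprema: \<open>\<Omega>\<close> may be
  Lebesgue null. For empty \<open>\<Omega>\<close> the last condition forces \<open>f\<close> to vanish on test functions, so the
  unspecified value of the real supremum over the empty set is harmless.\<close>

definition X0 :: "(real^'n) set \<Rightarrow> ((real^'n \<Rightarrow> real) \<Rightarrow> real) set" where
  "X0 \<Omega> = {f. distribution f \<and>
     (\<exists>C. \<forall>\<phi>\<in>test_functions. f \<phi> \<le> C * (sup_norm_on \<Omega> \<phi> + sup_norm_on \<Omega> (gradient \<phi>))) \<and>
     (\<forall>\<phi>\<in>test_functions. \<phi> constant_on \<Omega> \<longrightarrow> f \<phi> = 0)}"

text \<open>The extension by continuity of \<open>f\<close> to compactly supported \<open>C\<^sup>1\<close> functions: test functions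
  are dense there for uniform convergence of values and gradients, and the estimate in \<open>X0\<close> makes
  the limit exist and be independent of the approximating sequence.\<close>

definition C1_extension :: "((real^'n \<Rightarrow> real) \<Rightarrow> real) \<Rightarrow> (real^'n \<Rightarrow> real) \<Rightarrow> real" where
  "C1_extension f \<phi> = (THE l. \<forall>\<psi>. (\<forall>k. \<psi> k \<in> test_functions) \<longrightarrow>
     uniform_limit UNIV \<psi> \<phi> sequentially \<longrightarrow>
     uniform_limit UNIV (\<lambda>k. gradient (\<psi> k)) (gradient \<phi>) sequentially \<longrightarrow>
     (\<lambda>k. f (\<psi> k)) \<longlonglongrightarrow> l)"

definition diff_quot :: "(real^'n \<Rightarrow> real) \<Rightarrow> (real^'n) \<times> (real^'n) \<times> real \<Rightarrow> real" where
  "diff_quot \<phi> = (\<lambda>(x, v, t). if t \<noteq> 0 then (\<phi> (x + t *\<^sub>R v) - \<phi> x) / t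
                               else frechet_derivative \<phi> (at x) v)"

text \<open>On this locally compact, \<open>\<sigma>\<close>-compact metric space every finite Borel measure is Radon.\<close>

definition pos_finite_measures ::
    "(real^'n) set \<Rightarrow> ((real^'n) \<times> (real^'n) \<times> real) measure set" where
  "pos_finite_measures \<Omega> = {\<sigma>. finite_measure \<sigma> \<and>
     sets \<sigma> = sets (restrict_space borel (\<Omega> \<times> sphere 0 1 \<times> {0..}))}"

definition representing_measures ::
    "(real^'n) set \<Rightarrow> ((real^'n \<Rightarrow> real) \<Rightarrow> real) \<Rightarrow> ((real^'n) \<times> (real^'n) \<times> real) measure set" where
  "representing_measures \<Omega> f = {\<sigma> \<in> pos_finite_measures \<Omega>.
     \<forall>\<phi>\<in>C1_compact. (\<integral>z. diff_quot \<phi> z \<partial>\<sigma>) = C1_extension f \<phi>}"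

text \<open>The total variation of a positive measure is its total mass.\<close>

definition total_variation :: "'a measure \<Rightarrow> real" where
  "total_variation \<sigma> = measure \<sigma> (space \<sigma>)"

definition W1 :: "((real^'n \<Rightarrow> real) \<Rightarrow> real) \<Rightarrow> ereal" where
  "W1 f = (SUP u \<in> {u \<in> C1_compact. \<forall>x. norm (gradient u x) \<le> 1}. ereal (C1_extension f u))"

end

theory Submission
  imports Defs "HOL-Probability.Helly_Selection" "HOL-Probability.Probability_Mass_Function"
begin

text \<open>Integrating \<open>D\<^sub>u \<le> 1\<close> shows that every representing measure has mass at least \<open>W1 f\<close>, so it
  suffices to find one of mass \<open>W1 f\<close>, and it can be concentrated on \<open>t = 0\<close>. There \<open>D\<^sub>\<phi>\<close> is
  \<open>(x, v) \<mapsto> \<nabla>\<phi>(x) \<bullet> v\<close> on the compact set \<open>\<Omega> \<times> S\<close>, and by Hahn--Banach and Riesz the measure exists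
  as soon as \<open>\<langle>f, \<phi>\<rangle> \<le> W1 f \<cdot> sup\<^sub>\<Omega> |\<nabla>\<phi>|\<close>. Convexity of \<open>\<Omega>\<close> gives this: up to a small error, \<open>\<phi>\<close> can
  be changed away from \<open>\<Omega>\<close> so that the bound on its gradient holds globally.

  The representation theorem on a compact set \<open>K\<close> is obtained without dual spaces. Finitely many
  moments are matched approximately by finitely supported probabilities, and these converge weakly
  along a subsequence: a space-filling curve transports them to the real line, where Helly's
  selection theorem applies.\<close>

section \<open>Test functions and smooth bumps\<close>

text \<open>The estimate defining \<open>X0\<close> sees values and gradients on \<Omega> only,
  whereas \<open>W1\<close> restricts gradients everywhere. The link is a single inequality:
  \<open>\<bar>f \<phi>\<bar> \<le> C * B\<close> whenever the gradient of \<open>\<phi>\<close> is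
  at most \<open>B\<close> on \<Omega>. It makes changes away from \<Omega> harmless and yields the
  extension to C1 functions. The domination fed into the representation theorem is one-sided,
  \<open>l \<le> W * sup g\<close> without absolute value; this is what produces a positive measure.
  It is available because the supremum of \<open>gradient \<phi> x \<bullet> v\<close> over unit
  vectors \<open>v\<close> is already the norm of the gradient. If finitely many moments could not
  be approximated, a linear form would separate them from all attainable moment vectors, and
  domination forbids that. The argument is made quantitative, as a descent, so that no minimizing
  probability has to exist.\<close>

lemma frechet_derivative_eq_gradient:
  fixes \<phi> :: "real^'n \<Rightarrow> real"
  assumes "\<phi> differentiable (at x)"
  shows "frechet_derivative \<phi> (at x) v = gradient \<phi> x \<bullet> v"
proof -
  interpret D: linear "frechet_derivative \<phi> (at x)"
    using assms by (rule linear_frechet_derivative)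
  have "frechet_derivative \<phi> (at x) v = frechet_derivative \<phi> (at x) (\<Sum>i\<in>UNIV. v $ i *\<^sub>R axis i 1)"
    using basis_expansion[of v] by (simp add: scalar_mult_eq_scaleR)
  then show ?thesis
    by (simp add: D.sum D.scale gradient_def inner_vec_def mult.commute)
qed

lemma has_derivative_gradient:
  assumes "\<phi> differentiable (at x)"
  shows "(\<phi> has_derivative (\<lambda>v. gradient \<phi> x \<bullet> v)) (at x)"
proof -
  have "frechet_derivative \<phi> (at x) = (\<lambda>v. gradient \<phi> x \<bullet> v)"
    using frechet_derivative_eq_gradient[OF assms] by (intro ext)
  then show ?thesis
    using assms[unfolded frechet_derivative_works] by simp
qed

lemma gradient_eqI:
  assumes "(\<phi> has_derivative (\<lambda>v. g \<bullet> v)) (at x)"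
  shows "gradient \<phi> x = g"
  using frechet_derivative_at[OF assms]
  by (simp add: gradient_def vec_eq_iff inner_axis flip: frechet_derivative_at[OF assms])

lemma gradient_const [simp]: "gradient (\<lambda>_. c) x = 0"
  by (rule gradient_eqI) simp

lemma gradient_nth: "gradient \<phi> x $ i = iterated_partial [i] \<phi> x"
  by (simp add: gradient_def)

text \<open>The head of the list is the derivative taken last. Since \<open>smooth_partial\<close>
  differentiates first in direction \<open>i\<close>, that index has to go to the end of the
  list.\<close>

lemma iterated_partial_append:
  "iterated_partial (is @ js) \<phi> = iterated_partial is (iterated_partial js \<phi>)"
  by (induction "is") auto

text \<open>Smoothness is the greatest class of differentiable functions closed under partial
  derivatives. An invariant class \<open>G\<close> replaces formulas for iterated partials; linear
  combinations, bumps and convolutions are handled this way.\<close>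

lemma smooth_coinduct:
  assumes "g \<in> G" and diff: "\<And>g x. g \<in> G \<Longrightarrow> g differentiable (at x)"
    and partial: "\<And>g i. g \<in> G \<Longrightarrow> (\<lambda>x. frechet_derivative g (at x) (axis i 1)) \<in> G"
  shows "smooth g"
proof -
  have "iterated_partial is g \<in> G" for "is"
    by (induction "is") (auto intro: assms)
  then show ?thesis
    using diff by (auto simp: smooth_def)
qed

lemma smooth_differentiable: "smooth \<phi> \<Longrightarrow> \<phi> differentiable (at x)"
  unfolding smooth_def by (drule spec[of _ "[]"]) simp

lemma smooth_partial:
  assumes "smooth \<phi>"
  shows "smooth (\<lambda>x. frechet_derivative \<phi> (at x) (axis i 1))"
  using assms iterated_partial_append[of _ "[i]" \<phi>] by (simp add: smooth_def) metis

lemma smooth_linear_combination: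
  fixes \<phi> \<psi> :: "real^'n \<Rightarrow> real"
  assumes "smooth \<phi>" "smooth \<psi>"
  shows "smooth (\<lambda>x. a * \<phi> x + b * \<psi> x)"
proof (rule smooth_coinduct)
  let ?G = "{\<lambda>x. a * \<phi> x + b * \<psi> x | \<phi> \<psi> :: real^'n \<Rightarrow> real. smooth \<phi> \<and> smooth \<psi>}"
  show "(\<lambda>x. a * \<phi> x + b * \<psi> x) \<in> ?G" using assms by blast
  fix g assume "g \<in> ?G"
  then obtain \<phi> \<psi> where g: "g = (\<lambda>x. a * \<phi> x + b * \<psi> x)" "smooth \<phi>" "smooth \<psi>" by blast
  have *: "(g has_derivative (\<lambda>v. a * frechet_derivative \<phi> (at x) v + b * frechet_derivative \<psi> (at x) v)) (at x)" for x
    unfolding g(1) using g(2,3)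
    by (intro derivative_intros) (simp_all add: smooth_differentiable flip: frechet_derivative_works)
  show "g differentiable (at x)" for x
    using * by (auto simp: differentiable_def)
  show "(\<lambda>x. frechet_derivative g (at x) (axis i 1)) \<in> ?G" for i
    unfolding frechet_derivative_at[OF *, symmetric]
    using smooth_partial[OF g(2), of i] smooth_partial[OF g(3), of i]
    by (intro CollectI exI[of _ "\<lambda>x. frechet_derivative \<phi> (at x) (axis i 1)"]
        exI[of _ "\<lambda>x. frechet_derivative \<psi> (at x) (axis i 1)"] conjI refl)
qed

lemma compact_supp_iff: "compact (supp \<phi>) \<longleftrightarrow> (\<exists>R. \<forall>x. R < norm x \<longrightarrow> \<phi> x = 0)"
proof -
  have "compact (supp \<phi>) \<longleftrightarrow> (\<exists>R. \<forall>x\<in>{x. \<phi> x \<noteq> 0}. norm x \<le> R)"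
    unfolding supp_def by (simp only: compact_closure bounded_iff)
  also have "\<dots> \<longleftrightarrow> (\<exists>R. \<forall>x. R < norm x \<longrightarrow> \<phi> x = 0)"
    by (auto simp flip: not_le)
  finally show ?thesis .
qed

lemma gradient_eq_0_outside:
  assumes "\<And>x. R < norm x \<Longrightarrow> \<phi> x = 0" "R < norm x"
  shows "gradient \<phi> x = 0"
proof (rule gradient_eqI)
  have "open {x :: real^'n. R < norm x}"
    by (intro open_Collect_less continuous_intros)
  then have "(\<phi> has_derivative (\<lambda>_. 0)) (at x)"
    by (rule has_derivative_transform_within_open[OF has_derivative_const]) (use assms in auto)
  then show "(\<phi> has_derivative (\<lambda>v. 0 \<bullet> v)) (at x)" by simp
qed

lemma test_functions_linear_combination:
  assumes "\<phi> \<in> test_functions" "\<psi> \<in> test_functions"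
  shows "(\<lambda>x. a * \<phi> x + b * \<psi> x) \<in> test_functions"
proof -
  obtain R S where "\<And>x. R < norm x \<Longrightarrow> \<phi> x = 0" "\<And>x. S < norm x \<Longrightarrow> \<psi> x = 0"
    using assms by (auto simp: test_functions_def compact_supp_iff)
  then have "\<And>x. max R S < norm x \<Longrightarrow> a * \<phi> x + b * \<psi> x = 0" by simp
  then show ?thesis
    using assms smooth_linear_combination[of \<phi> \<psi> a b]
    by (auto simp: test_functions_def compact_supp_iff intro!: exI[of _ "max R S"])
qed

lemma test_functions_C1_compact:
  assumes "\<phi> \<in> test_functions"
  shows "\<phi> \<in> C1_compact"
proof -
  have "continuous_on UNIV (gradient \<phi>)"
    unfolding gradient_def using assms
    by (intro continuous_on_vec_lambda continuous_at_imp_continuous_on ballI differentiable_imp_continuous_within)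
       (auto simp: test_functions_def intro!: smooth_differentiable smooth_partial)
  then show ?thesis
    using assms by (auto simp: C1_compact_def test_functions_def smooth_differentiable)
qed

lemma test_functions_partial:
  assumes "\<phi> \<in> test_functions"
  shows "(\<lambda>x. frechet_derivative \<phi> (at x) (axis i 1)) \<in> test_functions"
proof -
  obtain R where "\<And>x. R < norm x \<Longrightarrow> \<phi> x = 0"
    using assms by (auto simp: test_functions_def compact_supp_iff)
  then have "gradient \<phi> x $ i = 0" if "R < norm x" for x
    using gradient_eq_0_outside[of R \<phi> x] that by simp
  then show ?thesis
    using assms smooth_partial[of \<phi> i] by (auto simp: test_functions_def compact_supp_iff gradient_nth)
qed

lemma C1_compactD:
  assumes "\<phi> \<in> C1_compact"
  shows "\<phi> differentiable (at x)" "(\<phi> has_derivative (\<lambda>v. gradient \<phi> x \<bullet> v)) (at x)"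
    "continuous_on UNIV \<phi>" "continuous_on UNIV (gradient \<phi>)"
    "\<exists>R. \<forall>x. R < norm x \<longrightarrow> \<phi> x = 0 \<and> gradient \<phi> x = 0"
proof -
  show d: "\<phi> differentiable (at x)" for x
    using assms by (auto simp: C1_compact_def)
  then show "(\<phi> has_derivative (\<lambda>v. gradient \<phi> x \<bullet> v)) (at x)"
    by (rule has_derivative_gradient)
  show "continuous_on UNIV \<phi>"
    using d by (intro continuous_at_imp_continuous_on ballI differentiable_imp_continuous_within)
  show "continuous_on UNIV (gradient \<phi>)" using assms by (auto simp: C1_compact_def)
  obtain R where "\<And>x. R < norm x \<Longrightarrow> \<phi> x = 0"
    using assms by (auto simp: C1_compact_def compact_supp_iff)
  then show "\<exists>R. \<forall>x. R < norm x \<longrightarrow> \<phi> x = 0 \<and> gradient \<phi> x = 0"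
    using gradient_eq_0_outside by blast
qed

lemma gradient_linear_combination:
  assumes "\<phi> differentiable (at x)" "\<psi> differentiable (at x)"
  shows "gradient (\<lambda>x. a * \<phi> x + b * \<psi> x) x = a *\<^sub>R gradient \<phi> x + b *\<^sub>R gradient \<psi> x"
proof (rule gradient_eqI)
  show "((\<lambda>x. a * \<phi> x + b * \<psi> x) has_derivative (\<lambda>v. (a *\<^sub>R gradient \<phi> x + b *\<^sub>R gradient \<psi> x) \<bullet> v)) (at x)"
    using has_derivative_gradient[OF assms(1)] has_derivative_gradient[OF assms(2)]
    by (auto intro!: derivative_eq_intros simp: inner_add_left)
qed

lemma C1_compact_linear_combination:
  assumes "\<phi> \<in> C1_compact" "\<psi> \<in> C1_compact"
  shows "(\<lambda>x. a * \<phi> x + b * \<psi> x) \<in> C1_compact"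
proof -
  note d = C1_compactD(1)[OF assms(1)] C1_compactD(1)[OF assms(2)]
  have "gradient (\<lambda>x. a * \<phi> x + b * \<psi> x) = (\<lambda>x. a *\<^sub>R gradient \<phi> x + b *\<^sub>R gradient \<psi> x)"
    using gradient_linear_combination[OF d] by blast
  moreover have "continuous_on UNIV (\<lambda>x. a *\<^sub>R gradient \<phi> x + b *\<^sub>R gradient \<psi> x)"
    using C1_compactD(4)[OF assms(1)] C1_compactD(4)[OF assms(2)] by (intro continuous_intros)
  moreover obtain R S where "\<And>x. R < norm x \<Longrightarrow> \<phi> x = 0" "\<And>x. S < norm x \<Longrightarrow> \<psi> x = 0"
    using assms by (auto simp: C1_compact_def compact_supp_iff)
  then have "\<And>x. max R S < norm x \<Longrightarrow> a * \<phi> x + b * \<psi> x = 0" by simp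
  then have "compact (supp (\<lambda>x. a * \<phi> x + b * \<psi> x))"
    unfolding compact_supp_iff by blast
  moreover have "(\<lambda>x. a * \<phi> x + b * \<psi> x) differentiable (at x)" for x
    using d by (intro derivative_intros)
  ultimately show ?thesis
    by (auto simp: C1_compact_def)
qed

text \<open>\<open>flat_exp 0\<close> is the classical smooth function \<open>exp (- 1 / t)\<close>
  extended by zero. Powers of \<open>1 / t\<close> are included because differentiation creates
  them: the derivative of a member is a linear combination of members.\<close>

definition flat_exp :: "nat \<Rightarrow> real \<Rightarrow> real" where
  "flat_exp k t = (if 0 < t then exp (- inverse t) * inverse t ^ k else 0)"

text \<open>The series term of index \<open>k + 2\<close> gives
  \<open>s ^ (k + 2) \<le> fact (k + 2) * exp s\<close> at \<open>s = 1 / t\<close>. The two extra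
  powers leave the factor \<open>t\<^sup>2\<close>, enough for a zero derivative at the
  origin.\<close>

lemma flat_exp_bound: "\<bar>flat_exp k t\<bar> \<le> fact (k + 2) * t\<^sup>2"
proof (cases "0 < t")
  case True
  define F where "F = (fact (k + 2) :: real)"
  have F: "F > 0" by (simp add: F_def)
  have "inverse t ^ (k + 2) /\<^sub>R F = (\<Sum>n\<in>{k + 2}. inverse t ^ n /\<^sub>R fact n)" by (simp add: F_def)
  also have "\<dots> \<le> exp (inverse t)"
    unfolding exp_def by (rule sum_le_suminf[OF summable_exp_generic]) (use True in auto)
  finally have "inverse t ^ (k + 2) / F \<le> exp (inverse t)"
    by (simp only: real_scaleR_def divide_inverse mult.commute)
  then have "inverse t ^ (k + 2) \<le> exp (inverse t) * F"
    using F by (simp only: pos_divide_le_eq)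
  then have "exp (- inverse t) * inverse t ^ (k + 2) \<le> exp (- inverse t) * (exp (inverse t) * F)"
    by (rule mult_left_mono) simp
  also have "\<dots> = F"
    by (simp add: exp_minus)
  finally have "exp (- inverse t) * inverse t ^ (k + 2) \<le> F" .
  then have "exp (- inverse t) * inverse t ^ (k + 2) * t\<^sup>2 \<le> F * t\<^sup>2"
    by (rule mult_right_mono) simp
  moreover have "inverse t ^ (k + 2) * t\<^sup>2 = inverse t ^ k"
    using True by (simp add: power_add field_simps power2_eq_square)
  ultimately have "exp (- inverse t) * inverse t ^ k \<le> F * t\<^sup>2"
    by (simp only: mult.assoc)
  then show ?thesis
    using True by (simp add: flat_exp_def F_def)
qed (simp add: flat_exp_def)

lemma flat_exp_deriv:
  "(flat_exp k has_real_derivative - real k * flat_exp (Suc k) t + flat_exp (k + 2) t) (at t)"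
proof (cases t "0 :: real" rule: linorder_cases)
  case less
  have "((\<lambda>_. 0) has_real_derivative 0) (at t)" by simp
  then have "(flat_exp k has_real_derivative 0) (at t)"
    by (rule has_field_derivative_transform_within_open[of _ _ _ "{..<0}"]) (use less in \<open>auto simp: flat_exp_def\<close>)
  then show ?thesis using less by (simp add: flat_exp_def)
next
  case equal
  have zero: "flat_exp j 0 = 0" for j by (simp add: flat_exp_def)
  have "((\<lambda>h. (flat_exp k (0 + h) - flat_exp k 0) / h) \<longlongrightarrow> 0) (at 0)"
  proof (rule tendsto_0_le[where K="fact (k + 2)"])
    show "((\<lambda>h :: real. h) \<longlongrightarrow> 0) (at 0)" by (rule tendsto_ident_at)
    have "norm ((flat_exp k (0 + h) - flat_exp k 0) / h) \<le> norm h * fact (k + 2)" for h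
    proof (cases "h = 0")
      case False
      have "norm ((flat_exp k (0 + h) - flat_exp k 0) / h) = \<bar>flat_exp k h\<bar> / \<bar>h\<bar>"
        by (simp add: zero)
      also have "\<dots> \<le> (fact (k + 2) * h\<^sup>2) / \<bar>h\<bar>"
        by (intro divide_right_mono flat_exp_bound) simp
      also have "\<dots> = norm h * fact (k + 2)"
        using False by (cases "h > 0") (simp_all add: power2_eq_square mult.commute)
      finally show ?thesis .
    qed simp
    then show "\<forall>\<^sub>F h in at 0. norm ((flat_exp k (0 + h) - flat_exp k 0) / h) \<le> norm h * fact (k + 2)"
      by (intro always_eventually allI)
  qed
  then have "(flat_exp k has_real_derivative 0) (at 0)"
    unfolding DERIV_def .
  then show ?thesis
    using equal by (simp add: zero)
next
  case greater
  have inv: "(inverse has_real_derivative - (inverse t)\<^sup>2) (at t)"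
    using DERIV_inverse[of t] greater by (simp add: numeral_2_eq_2)
  have "((\<lambda>t. exp (- inverse t) * inverse t ^ k) has_real_derivative
      exp (- inverse t) * (inverse t)\<^sup>2 * inverse t ^ k
      + real k * inverse t ^ (k - 1) * - (inverse t)\<^sup>2 * exp (- inverse t)) (at t)"
    using DERIV_mult[OF DERIV_fun_exp[OF DERIV_minus[OF inv]] DERIV_power[OF inv, of k]]
    by (simp add: mult.commute mult.left_commute)
  moreover
  \<comment> \<open>For \<open>k = 0\<close> the exponent \<open>k - 1\<close> is truncated to 0,
    but the factor \<open>real k\<close> vanishes.\<close>
  have "real k * inverse t ^ (k - 1) * - (inverse t)\<^sup>2 = - real k * inverse t ^ Suc k"
    by (cases k) (simp_all add: power2_eq_square algebra_simps)
  then have "exp (- inverse t) * (inverse t)\<^sup>2 * inverse t ^ k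
      + real k * inverse t ^ (k - 1) * - (inverse t)\<^sup>2 * exp (- inverse t)
      = - real k * flat_exp (Suc k) t + flat_exp (k + 2) t"
    using greater by (simp only: flat_exp_def if_True) (simp add: power2_eq_square)
  ultimately have "((\<lambda>t. exp (- inverse t) * inverse t ^ k) has_real_derivative
      - real k * flat_exp (Suc k) t + flat_exp (k + 2) t) (at t)"
    by (rule DERIV_cong)
  then show ?thesis
    by (rule has_field_derivative_transform_within_open[of _ _ _ "{0<..}"]) (use greater in \<open>auto simp: flat_exp_def\<close>)
qed

text \<open>The invariant class for \<open>smooth_coinduct\<close>. Coordinates are included because
  the chain rule for \<open>r - x \<bullet> x\<close> yields the factor
  \<open>- 2 * x $ i\<close>.\<close>

inductive_set bump_algebra :: "real \<Rightarrow> (real^'n \<Rightarrow> real) set" for r where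
  const: "(\<lambda>_. c) \<in> bump_algebra r"
| coordinate: "(\<lambda>x. x $ i) \<in> bump_algebra r"
| flat: "(\<lambda>x. flat_exp k (r - x \<bullet> x)) \<in> bump_algebra r"
| add: "f \<in> bump_algebra r \<Longrightarrow> g \<in> bump_algebra r \<Longrightarrow> (\<lambda>x. f x + g x) \<in> bump_algebra r"
| mult: "f \<in> bump_algebra r \<Longrightarrow> g \<in> bump_algebra r \<Longrightarrow> (\<lambda>x. f x * g x) \<in> bump_algebra r"

lemma bump_algebra_derivative:
  fixes f :: "real^'n \<Rightarrow> real"
  assumes "f \<in> bump_algebra r"
  shows "\<exists>f'. (\<forall>x. (f has_derivative f' x) (at x)) \<and> (\<forall>i. (\<lambda>x. f' x (axis i 1)) \<in> bump_algebra r)"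
  using assms
proof induction
  case (const c)
  show ?case by (intro exI[of _ "\<lambda>_ _. 0"]) (auto intro: bump_algebra.intros)
next
  case (coordinate j)
  have "(\<lambda>x. axis i 1 $ j :: real) \<in> bump_algebra r" for i :: 'n
    by (rule bump_algebra.const)
  moreover have "((\<lambda>x. x $ j) has_derivative (\<lambda>v. v $ j)) (at x)" for x :: "real^'n"
    by (rule bounded_linear_imp_has_derivative) (rule bounded_linear_vec_nth)
  ultimately show ?case by (intro exI[of _ "\<lambda>_ v. v $ j"]) auto
next
  case (flat k)
  define D where "D x v = (- real k * flat_exp (Suc k) (r - x \<bullet> x) + flat_exp (k + 2) (r - x \<bullet> x)) * (- 2 * (x \<bullet> v))"
    for x v :: "real^'n"
  have "((\<lambda>x. flat_exp k (r - x \<bullet> x)) has_derivative D x) (at x)" for x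
  proof -
    have "((\<lambda>x. r - x \<bullet> x) has_derivative (\<lambda>v. - 2 * (x \<bullet> v))) (at x)"
      by (auto intro!: derivative_eq_intros simp: inner_commute)
    from has_derivative_compose[OF this flat_exp_deriv[of k, unfolded has_field_derivative_def]]
    show ?thesis unfolding D_def .
  qed
  moreover have "(\<lambda>x. D x (axis i 1)) \<in> bump_algebra r" for i
    unfolding D_def inner_axis inner_real_def mult_1_right by (intro bump_algebra.intros)
  ultimately show ?case by blast
next
  case (add f g)
  then obtain f' g' where *: "\<forall>x. (f has_derivative f' x) (at x)" "\<forall>i. (\<lambda>x. f' x (axis i 1)) \<in> bump_algebra r"
    "\<forall>x. (g has_derivative g' x) (at x)" "\<forall>i. (\<lambda>x. g' x (axis i 1)) \<in> bump_algebra r" by blast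
  then show ?case
    by (intro exI[of _ "\<lambda>x v. f' x v + g' x v"]) (auto intro: bump_algebra.intros has_derivative_add)
next
  case (mult f g)
  then obtain f' g' where *: "\<forall>x. (f has_derivative f' x) (at x)" "\<forall>i. (\<lambda>x. f' x (axis i 1)) \<in> bump_algebra r"
    "\<forall>x. (g has_derivative g' x) (at x)" "\<forall>i. (\<lambda>x. g' x (axis i 1)) \<in> bump_algebra r" by blast
  then show ?case using mult.hyps
    by (intro exI[of _ "\<lambda>x v. f x * g' x v + f' x v * g x"]) (auto intro!: bump_algebra.intros has_derivative_mult)
qed

lemma smooth_bump_algebra:
  assumes "f \<in> bump_algebra r"
  shows "smooth f"
proof (rule smooth_coinduct[of _ "bump_algebra r"])
  fix g :: "real^'n \<Rightarrow> real" assume "g \<in> bump_algebra r"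
  then obtain g' where g': "\<And>x. (g has_derivative g' x) (at x)" "\<And>i. (\<lambda>x. g' x (axis i 1)) \<in> bump_algebra r"
    using bump_algebra_derivative by blast
  show "g differentiable (at x)" for x using g'(1) by (auto simp: differentiable_def)
  show "(\<lambda>x. frechet_derivative g (at x) (axis i 1)) \<in> bump_algebra r" for i
    using g'(2)[of i] frechet_derivative_at[OF g'(1)] by simp
qed fact

lemma zero_test_function: "(\<lambda>_. 0) \<in> test_functions"
  using smooth_bump_algebra[OF bump_algebra.const, of 0] by (simp add: test_functions_def compact_supp_iff)

section \<open>Integrability and mollifiers\<close>

lemma continuous_compact_supp_integrable:
  fixes f :: "real^'n \<Rightarrow> 'b::{banach, second_countable_topology}"
  assumes "continuous_on UNIV f" "\<And>x. R < norm x \<Longrightarrow> f x = 0"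
  shows "integrable lborel f"
proof -
  have "integrable lborel (\<lambda>x. indicator (cball 0 R) x *\<^sub>R f x)"
    using continuous_on_subset[OF assms(1)] by (intro borel_integrable_compact) auto
  also have "(\<lambda>x. indicator (cball 0 R) x *\<^sub>R f x) = f"
    using assms(2) by (auto simp: indicator_def fun_eq_iff not_le)
  finally show ?thesis .
qed

definition mollifier :: "real \<Rightarrow> (real^'n \<Rightarrow> real) \<Rightarrow> bool" where
  "mollifier r \<rho> \<longleftrightarrow> \<rho> \<in> test_functions \<and> (\<forall>x. 0 \<le> \<rho> x) \<and> (\<forall>x. r \<le> norm x \<longrightarrow> \<rho> x = 0) \<and> integral\<^sup>L lborel \<rho> = 1"

lemma ex_mollifier:
  assumes "r > 0"
  shows "\<exists>\<rho> :: real^'n \<Rightarrow> real. mollifier r \<rho>"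
proof -
  \<comment> \<open>The argument is positive exactly on the open ball of radius
    \<open>r\<close>.\<close>
  define b where "b x = flat_exp 0 (r\<^sup>2 - x \<bullet> x)" for x :: "real^'n"
  have b_smooth: "smooth b"
    unfolding b_def by (rule smooth_bump_algebra[OF bump_algebra.flat])
  have b_pos: "b x > 0 \<longleftrightarrow> norm x < r" "b x \<ge> 0" for x
    using assms by (auto simp: b_def flat_exp_def norm_lt_square dot_square_norm power_mono_iff real_sqrt_less_iff abs_square_less_1
      dest: power2_less_imp_less intro: power_strict_mono)
  have b_0: "b x = 0" if "r \<le> norm x" for x
    using b_pos[of x] that by linarith
  have cont: "continuous_on UNIV b"
    using b_smooth by (intro continuous_at_imp_continuous_on ballI differentiable_imp_continuous_within smooth_differentiable)
  have int: "integrable lborel b"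
    using continuous_compact_supp_integrable[OF cont, of r] b_0 by simp
  define Z where "Z = integral\<^sup>L lborel b"
  \<comment> \<open>Otherwise the nonnegative \<open>b\<close> would vanish almost everywhere,
    although it is positive on a ball of positive volume.\<close>
  have "Z \<noteq> 0"
  proof
    assume "Z = 0"
    then have "AE x in lborel. b x = 0"
      using int b_pos(2) by (simp add: Z_def integral_nonneg_eq_0_iff_AE)
    then have "AE x in lborel. x \<notin> ball (0 :: real^'n) r"
      by eventually_elim (metis b_pos(1) less_irrefl mem_ball_0)
    then have "emeasure lborel (ball (0 :: real^'n) r) = 0"
      by (subst (asm) AE_iff_null_sets[symmetric]) auto
    moreover have "0 < unit_ball_vol (real CARD('n)) * r ^ CARD('n)"
      using assms by (intro mult_pos_pos zero_less_power unit_ball_vol_pos) auto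
    ultimately show False
      using assms by (simp add: emeasure_ball)
  qed
  moreover have "Z \<ge> 0" unfolding Z_def using b_pos by (intro integral_nonneg_AE) auto
  ultimately have Z: "Z > 0" by simp
  have "b \<in> test_functions"
    using b_smooth b_0 by (auto simp: test_functions_def compact_supp_iff intro!: exI[of _ r])
  from test_functions_linear_combination[OF this this, of "1 / Z" 0]
  have "(\<lambda>x. b x / Z) \<in> test_functions" by simp
  then have "mollifier r (\<lambda>x. b x / Z)"
    using b_0 b_pos Z by (auto simp: mollifier_def Z_def)
  then show ?thesis by blast
qed

section \<open>Mollification\<close>

text \<open>The second factor may be vector-valued so that gradients can be convolved; derivatives
  always fall on this factor.\<close>

definition convolution :: "(real^'n \<Rightarrow> real) \<Rightarrow> (real^'n \<Rightarrow> 'b::euclidean_space) \<Rightarrow> real^'n \<Rightarrow> 'b" where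
  "convolution g h x = (\<integral>y. g y *\<^sub>R h (x - y) \<partial>lborel)"

lemma uniformly_continuous_compact_supp:
  fixes f :: "'a::euclidean_space \<Rightarrow> 'b::real_normed_vector"
  assumes f: "continuous_on UNIV f" "\<And>x. R < norm x \<Longrightarrow> f x = 0" and e: "e > 0"
  obtains d where "d > 0" "\<And>x y. norm (x - y) < d \<Longrightarrow> norm (f x - f y) < e"
proof -
  \<comment> \<open>The radius exceeds \<open>R\<close> by 1 and the final modulus is at most 1: two
    close points lie both in this ball or both where \<open>f\<close> vanishes.\<close>
  have "uniformly_continuous_on (cball 0 (R + 1)) f"
    using continuous_on_subset[OF f(1)] by (intro compact_uniformly_continuous) auto
  then obtain d where d: "d > 0"
    "\<And>x y. x \<in> cball 0 (R + 1) \<Longrightarrow> y \<in> cball 0 (R + 1) \<Longrightarrow> dist y x < d \<Longrightarrow> dist (f y) (f x) < e"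
    using e unfolding uniformly_continuous_on_def by meson
  show thesis
  proof (rule that[of "min d 1"])
    show "min d 1 > 0" using d by simp
    fix x y :: 'a assume xy: "norm (x - y) < min d 1"
    then have n: "norm x \<le> norm y + 1" "norm y \<le> norm x + 1"
      using norm_triangle_sub[of x y] norm_triangle_sub[of y x] by (auto simp: norm_minus_commute)
    show "norm (f x - f y) < e"
    proof (cases "norm x \<le> R + 1 \<and> norm y \<le> R + 1")
      case True
      then show ?thesis using d(2)[of y x] xy by (simp add: dist_norm)
    next
      case False
      then have "f x = 0" "f y = 0" using n by (auto intro!: f(2))
      then show ?thesis using e by simp
    qed
  qed
qed

lemma convolution_integrable:
  fixes h :: "real^'n \<Rightarrow> 'b::euclidean_space"
  assumes g: "continuous_on UNIV g" "\<And>x. R < norm x \<Longrightarrow> g x = 0" and h: "continuous_on UNIV h"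
  shows "integrable lborel (\<lambda>y. g y *\<^sub>R h (x - y))"
proof (rule continuous_compact_supp_integrable)
  have "continuous_on UNIV (\<lambda>y. h (x - y))"
    by (rule continuous_on_compose2[OF h]) (auto intro!: continuous_intros)
  then show "continuous_on UNIV (\<lambda>y. g y *\<^sub>R h (x - y))"
    by (intro continuous_intros g)
qed (use g in auto)

text \<open>Uniform continuity of the gradient of \<open>h\<close> makes the linearization error at
  most \<open>e / (G + 1) * norm v\<close>, uniformly in the base point. Integrating against
  \<open>\<bar>g\<bar>\<close>, of total mass \<open>G\<close>, keeps it below
  \<open>e * norm v\<close>; the added 1 covers \<open>G = 0\<close>.\<close>

lemma convolution_has_derivative:
  fixes h :: "real^'n \<Rightarrow> real"
  assumes g: "continuous_on UNIV g" "\<And>x. R < norm x \<Longrightarrow> g x = 0" and h: "h \<in> C1_compact"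
  shows "(convolution g h has_derivative (\<lambda>v. convolution g (gradient h) x \<bullet> v)) (at x)"
  unfolding has_derivative_at_alt
proof (intro conjI allI impI)
  show "bounded_linear (\<lambda>v. convolution g (gradient h) x \<bullet> v)"
    by (rule bounded_linear_inner_right)
  fix e :: real assume e: "e > 0"
  define G where "G = (\<integral>y. \<bar>g y\<bar> \<partial>lborel)"
  have g_int: "integrable lborel (\<lambda>y. \<bar>g y\<bar>)"
    using continuous_compact_supp_integrable[OF g] by simp
  have G: "G \<ge> 0" unfolding G_def by simp
  obtain S where "\<And>x. S < norm x \<Longrightarrow> gradient h x = 0"
    using C1_compactD(5)[OF h] by blast
  then obtain d where d: "d > 0" "\<And>x y. norm (x - y) < d \<Longrightarrow> norm (gradient h x - gradient h y) < e / (G + 1)"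
    using uniformly_continuous_compact_supp[OF C1_compactD(4)[OF h], of S "e / (G + 1)"] e G by auto
  have lin: "\<bar>h (z + v) - h z - gradient h z \<bullet> v\<bar> \<le> norm v * (e / (G + 1))" if v: "norm v < d" for z v
  proof -
    have "norm (h (z + v) - h z - (\<lambda>v. gradient h z \<bullet> v) (z + v - z)) \<le> norm (z + v - z) * (e / (G + 1))"
    proof (rule differentiable_bound_linearization[where S="ball z d" and f'="\<lambda>x v. gradient h x \<bullet> v"])
      show "z + t *\<^sub>R (z + v - z) \<in> ball z d" if "t \<in> {0..1}" for t
      proof -
        have "t * norm v \<le> 1 * norm v" using that by (intro mult_right_mono) auto
        then show ?thesis using v that by (simp add: dist_norm)
      qed
      show "(h has_derivative (\<lambda>v. gradient h x \<bullet> v)) (at x within ball z d)" for x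
        using C1_compactD(2)[OF h] by (rule has_derivative_at_withinI)
      fix x assume "x \<in> ball z d"
      then have "norm (gradient h x - gradient h z) \<le> e / (G + 1)"
        using d(2)[of x z] by (simp add: dist_norm norm_minus_commute)
      then have "norm ((gradient h x - gradient h z) \<bullet> i) \<le> e / (G + 1) * norm i" for i
        unfolding real_norm_def
        by (rule order_trans[OF Cauchy_Schwarz_ineq2 mult_right_mono]) simp
      then show "onorm ((\<lambda>v. gradient h x \<bullet> v) - (\<lambda>v. gradient h z \<bullet> v)) \<le> e / (G + 1)"
        unfolding fun_diff_def inner_diff_left[symmetric] by (rule onorm_le)
    qed (use d in auto)
    then show ?thesis by simp
  qed
  show "\<exists>d>0. \<forall>y. norm (y - x) < d \<longrightarrow>
      norm (convolution g h y - convolution g h x - convolution g (gradient h) x \<bullet> (y - x)) \<le> e * norm (y - x)"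
  proof (intro exI[of _ d] conjI allI impI d(1))
    fix y assume y: "norm (y - x) < d"
    define v where "v = y - x"
    have int: "integrable lborel (\<lambda>z. g z *\<^sub>R h (x' - z))" "integrable lborel (\<lambda>z. g z *\<^sub>R gradient h (x' - z))" for x'
      using convolution_integrable[OF g C1_compactD(3)[OF h]] convolution_integrable[OF g C1_compactD(4)[OF h]] by auto
    let ?f = "\<lambda>z. g z * (h ((x - z) + v) - h (x - z) - gradient h (x - z) \<bullet> v)"
    have eq: "?f = (\<lambda>z. g z *\<^sub>R h (y - z) - g z *\<^sub>R h (x - z) - (g z *\<^sub>R gradient h (x - z)) \<bullet> v)"
      by (simp add: v_def algebra_simps fun_eq_iff)
    note i = int(1)[of y] int(1)[of x] integrable_inner_left[OF int(2)[of x], of v]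
    have f_int: "integrable lborel ?f"
      unfolding eq by (intro Bochner_Integration.integrable_diff i)
    have "integral\<^sup>L lborel ?f = convolution g h y - convolution g h x - convolution g (gradient h) x \<bullet> v"
      unfolding eq convolution_def
      by (simp only: Bochner_Integration.integral_diff[OF Bochner_Integration.integrable_diff[OF i(1,2)] i(3)]
          Bochner_Integration.integral_diff[OF i(1,2)] integral_inner_left[OF int(2)])
    then have "convolution g h y - convolution g h x - convolution g (gradient h) x \<bullet> v = integral\<^sup>L lborel ?f"
      by (rule sym)
    also have "norm \<dots> \<le> (\<integral>z. \<bar>g z\<bar> * (norm v * (e / (G + 1))) \<partial>lborel)"
    proof (rule Bochner_Integration.integral_norm_bound_integral[OF f_int])
      show "integrable lborel (\<lambda>z. \<bar>g z\<bar> * (norm v * (e / (G + 1))))"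
        using g_int by (rule integrable_mult_left)
      show "norm (?f z) \<le> \<bar>g z\<bar> * (norm v * (e / (G + 1)))" for z
        unfolding abs_mult real_norm_def using y by (intro mult_left_mono lin) (simp_all add: v_def)
    qed
    also have "\<dots> = G * (norm v * (e / (G + 1)))"
      using g_int by (simp add: G_def)
    also have "\<dots> = e * norm v * (G / (G + 1))" by simp
    also have "\<dots> \<le> e * norm v * 1"
      using e G by (intro mult_left_mono) auto
    finally show "norm (convolution g h y - convolution g h x - convolution g (gradient h) x \<bullet> (y - x)) \<le> e * norm (y - x)"
      by (simp add: v_def)
  qed
qed

lemma convolution_eq_0_outside:
  assumes "\<And>x. R < norm x \<Longrightarrow> g x = 0" "\<And>x. S < norm x \<Longrightarrow> h x = 0" "R + S < norm x"
  shows "convolution g h x = 0"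
proof -
  have z: "g y *\<^sub>R h (x - y) = 0" for y
  proof (cases "R < norm y")
    case False
    then have "S < norm (x - y)"
      using assms(3) norm_triangle_sub[of x y] by linarith
    then show ?thesis using assms by simp
  qed (use assms in simp)
  show ?thesis unfolding convolution_def z by simp
qed

text \<open>Differentiation moves onto \<open>h\<close>, so the image of
  \<open>test_functions\<close> under convolution with \<open>g\<close> is closed under partial
  derivatives.\<close>

lemma convolution_test_function:
  fixes g h :: "real^'n \<Rightarrow> real"
  assumes g: "continuous_on UNIV g" "\<And>x. R < norm x \<Longrightarrow> g x = 0" and h: "h \<in> test_functions"
  shows "convolution g h \<in> test_functions"
proof -
  have "smooth (convolution g h)"
  proof (rule smooth_coinduct[of _ "convolution g ` test_functions"])
    show "convolution g h \<in> convolution g ` test_functions" using h by blast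
    fix k assume "k \<in> convolution g ` test_functions"
    then obtain h where h: "h \<in> test_functions" and k: "k = convolution g h" by blast
    have d: "(k has_derivative (\<lambda>v. convolution g (gradient h) x \<bullet> v)) (at x)" for x
      unfolding k by (rule convolution_has_derivative[OF g test_functions_C1_compact[OF h]])
    then show "k differentiable (at x)" for x by (rule differentiableI)
    fix i
    have "frechet_derivative k (at x) (axis i 1) = convolution g (\<lambda>x. frechet_derivative h (at x) (axis i 1)) x" for x
    proof -
      have "frechet_derivative k (at x) (axis i 1) = convolution g (gradient h) x \<bullet> axis i 1"
        using frechet_derivative_at[OF d, symmetric] by simp
      also have "\<dots> = (\<integral>y. (g y *\<^sub>R gradient h (x - y)) \<bullet> axis i 1 \<partial>lborel)"
        unfolding convolution_def
        by (intro integral_inner_left[symmetric] convolution_integrable[OF g] C1_compactD(4) test_functions_C1_compact h)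
      also have "\<dots> = convolution g (\<lambda>x. frechet_derivative h (at x) (axis i 1)) x"
        by (simp add: convolution_def gradient_def inner_axis)
      finally show ?thesis .
    qed
    then have "(\<lambda>x. frechet_derivative k (at x) (axis i 1)) = convolution g (\<lambda>x. frechet_derivative h (at x) (axis i 1))"
      by (intro ext)
    then show "(\<lambda>x. frechet_derivative k (at x) (axis i 1)) \<in> convolution g ` test_functions"
      using test_functions_partial[OF h, of i] by simp
  qed
  moreover obtain S where "\<And>x. S < norm x \<Longrightarrow> h x = 0"
    using h by (auto simp: test_functions_def compact_supp_iff)
  then have "compact (supp (convolution g h))"
    unfolding compact_supp_iff using convolution_eq_0_outside[of R g S h] g(2) by (intro exI[of _ "R + S"]) simp
  ultimately show ?thesis by (simp add: test_functions_def)
qed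

lemma lborel_integral_reflect:
  fixes f :: "'a::euclidean_space \<Rightarrow> real"
  assumes [measurable]: "f \<in> borel_measurable borel"
  shows "(\<integral>y. f (x - y) \<partial>lborel) = integral\<^sup>L lborel f"
proof -
  have "integral\<^sup>L lborel f = integral\<^sup>L (density (distr lborel borel (\<lambda>y. x + (-1) *\<^sub>R y)) (\<lambda>_. ennreal (\<bar>-1\<bar> ^ DIM('a)))) f"
    by (subst lborel_affine[of "-1" x]) simp_all
  also have "\<dots> = integral\<^sup>L (distr lborel borel (\<lambda>y. x - y)) f"
    by (subst integral_density) auto
  also have "\<dots> = (\<integral>y. f (x - y) \<partial>lborel)"
    by (subst integral_distr) auto
  finally show ?thesis by simp
qed

lemma convolution_commute:
  fixes g h :: "real^'n \<Rightarrow> real"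
  assumes g: "continuous_on UNIV g" and h: "continuous_on UNIV h"
  shows "convolution g h = convolution h g"
proof
  fix x
  have [measurable]: "g \<in> borel_measurable borel" "h \<in> borel_measurable borel"
    using assms borel_measurable_continuous_onI by blast+
  have "convolution h g x = (\<integral>y. h (x - y) * g (x - (x - y)) \<partial>lborel)"
    unfolding convolution_def real_scaleR_def by (rule lborel_integral_reflect[symmetric]) measurable
  then show "convolution g h x = convolution h g x"
    by (simp add: convolution_def mult.commute)
qed

lemma mollifierD:
  assumes "mollifier r \<rho>"
  shows "continuous_on UNIV \<rho>" "\<And>x. r < norm x \<Longrightarrow> \<rho> x = 0" "integrable lborel \<rho>"
proof -
  have *: "\<rho> \<in> test_functions" "\<And>x. r < norm x \<Longrightarrow> \<rho> x = 0"
    using assms by (auto simp: mollifier_def)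
  show "continuous_on UNIV \<rho>" using C1_compactD(3)[OF test_functions_C1_compact[OF *(1)]] .
  then show "integrable lborel \<rho>" using *(2) by (rule continuous_compact_supp_integrable)
qed (use assms in \<open>auto simp: mollifier_def\<close>)

text \<open>Since \<open>\<rho>\<close> is a probability density vanishing outside the ball of
  radius \<open>r\<close>, the convolution averages values of \<open>h\<close> within distance
  \<open>r\<close> of \<open>x\<close>.\<close>

lemma convolution_mollifier_bound:
  fixes h :: "real^'n \<Rightarrow> 'b::euclidean_space"
  assumes \<rho>: "mollifier r \<rho>" and h: "continuous_on UNIV h"
    and bound: "\<And>y. norm y < r \<Longrightarrow> norm (h (x - y) - c) \<le> e"
  shows "norm (convolution \<rho> h x - c) \<le> e"
proof -
  have int: "integrable lborel (\<lambda>y. \<rho> y *\<^sub>R h (x - y))" "integrable lborel (\<lambda>y. \<rho> y *\<^sub>R c)"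
    using convolution_integrable[OF mollifierD(1,2)[OF \<rho>] h] mollifierD(3)[OF \<rho>] by auto
  have c: "(\<integral>y. \<rho> y *\<^sub>R c \<partial>lborel) = c"
    using \<rho> mollifierD(3)[OF \<rho>] by (simp add: mollifier_def)
  have "convolution \<rho> h x - c = (\<integral>y. \<rho> y *\<^sub>R h (x - y) - \<rho> y *\<^sub>R c \<partial>lborel)"
    using int by (simp add: convolution_def c)
  also have "norm \<dots> \<le> (\<integral>y. \<rho> y * e \<partial>lborel)"
  proof (rule Bochner_Integration.integral_norm_bound_integral)
    show "norm (\<rho> y *\<^sub>R h (x - y) - \<rho> y *\<^sub>R c) \<le> \<rho> y * e" for y
    proof (cases "norm y < r")
      case True
      then show ?thesis
        using \<rho> bound[OF True] by (simp add: mollifier_def mult_left_mono flip: scaleR_diff_right)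
    next
      case False
      then show ?thesis using \<rho> by (simp add: mollifier_def)
    qed
  qed (use int mollifierD(3)[OF \<rho>] in auto)
  also have "\<dots> = e"
    using \<rho> mollifierD(3)[OF \<rho>] by (simp add: mollifier_def)
  finally show ?thesis .
qed

text \<open>Commuting the factors puts all derivatives on the mollifier.\<close>

lemma convolution_mollifier_test_function:
  fixes g :: "real^'n \<Rightarrow> real"
  assumes \<rho>: "mollifier r \<rho>" and g: "continuous_on UNIV g" "\<And>x. R < norm x \<Longrightarrow> g x = 0"
  shows "convolution \<rho> g \<in> test_functions"
  using convolution_test_function[OF g, where h=\<rho>] convolution_commute[OF g(1) mollifierD(1)[OF \<rho>]] \<rho>
  by (simp add: mollifier_def)

lemma gradient_convolution_mollifier:
  assumes "mollifier r \<rho>" "\<phi> \<in> C1_compact"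
  shows "gradient (convolution \<rho> \<phi>) = convolution \<rho> (gradient \<phi>)"
  using convolution_has_derivative[OF mollifierD(1,2)[OF assms(1)] assms(2)] gradient_eqI by blast

lemma mollification_approximates:
  fixes \<phi> :: "real^'n \<Rightarrow> real"
  assumes \<phi>: "\<phi> \<in> C1_compact" and e: "e > 0"
  obtains d where "d > 0" "\<And>r \<rho> x. r \<le> d \<Longrightarrow> mollifier r \<rho> \<Longrightarrow>
    \<bar>convolution \<rho> \<phi> x - \<phi> x\<bar> \<le> e \<and> norm (gradient (convolution \<rho> \<phi>) x - gradient \<phi> x) \<le> e"
proof -
  obtain R where R: "\<And>x. R < norm x \<Longrightarrow> \<phi> x = 0" "\<And>x. R < norm x \<Longrightarrow> gradient \<phi> x = 0"
    using C1_compactD(5)[OF \<phi>] by blast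
  obtain d1 where d1: "d1 > 0" "\<And>x y. norm (x - y) < d1 \<Longrightarrow> norm (\<phi> x - \<phi> y) < e"
    using uniformly_continuous_compact_supp[OF C1_compactD(3)[OF \<phi>] R(1) e] by blast
  obtain d2 where d2: "d2 > 0" "\<And>x y. norm (x - y) < d2 \<Longrightarrow> norm (gradient \<phi> x - gradient \<phi> y) < e"
    using uniformly_continuous_compact_supp[OF C1_compactD(4)[OF \<phi>] R(2) e] by blast
  show thesis
  proof (rule that[of "min d1 d2"])
    fix r and \<rho> :: "real^'n \<Rightarrow> real" and x assume r: "r \<le> min d1 d2" and \<rho>: "mollifier r \<rho>"
    have "norm (convolution \<rho> \<phi> x - \<phi> x) \<le> e"
      by (rule convolution_mollifier_bound[OF \<rho> C1_compactD(3)[OF \<phi>]])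
         (use r in \<open>auto intro!: less_imp_le d1(2)[unfolded real_norm_def]\<close>)
    moreover have "norm (convolution \<rho> (gradient \<phi>) x - gradient \<phi> x) \<le> e"
      by (rule convolution_mollifier_bound[OF \<rho> C1_compactD(4)[OF \<phi>]])
         (use r in \<open>auto intro!: less_imp_le d2(2)\<close>)
    ultimately show "\<bar>convolution \<rho> \<phi> x - \<phi> x\<bar> \<le> e \<and> norm (gradient (convolution \<rho> \<phi>) x - gradient \<phi> x) \<le> e"
      by (simp add: gradient_convolution_mollifier[OF \<rho> \<phi>])
  qed (use d1 d2 in simp)
qed

section \<open>Functionals bounded by the gradient\<close>

lemma gradient_cong_open:
  assumes "open S" "x \<in> S" "\<And>y. y \<in> S \<Longrightarrow> f y = g y" "f differentiable (at x)"
  shows "gradient g x = gradient f x"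
  using has_derivative_transform_within_open[OF has_derivative_gradient[OF assms(4)] assms(1-3)]
  by (rule gradient_eqI)

lemma cutoff_exists:
  fixes K :: "(real^'n) set"
  assumes "bounded K"
  obtains \<kappa> where "\<kappa> \<in> test_functions" "\<And>x. x \<in> K \<Longrightarrow> \<kappa> x = 1" "\<And>x. x \<in> K \<Longrightarrow> gradient \<kappa> x = 0"
proof -
  obtain B where B: "\<And>x. x \<in> K \<Longrightarrow> norm x \<le> B" using assms by (auto simp: bounded_iff)
  \<comment> \<open>The profile is 1 up to radius \<open>B + 2\<close>. Averaging over radius 1
    keeps the value 1 on the open ball of radius \<open>B + 1\<close>, a neighbourhood of
    \<open>K\<close>, so that the gradient vanishes on \<open>K\<close> too.\<close>
  define c :: "real^'n \<Rightarrow> real" where "c y = max 0 (min 1 (B + 3 - norm y))" for y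
  obtain \<rho> :: "real^'n \<Rightarrow> real" where \<rho>: "mollifier 1 \<rho>" using ex_mollifier[of 1] by auto
  have c: "continuous_on UNIV c" "\<And>x. B + 3 < norm x \<Longrightarrow> c x = 0"
    unfolding c_def by (auto intro!: continuous_intros)
  define \<kappa> where "\<kappa> = convolution \<rho> c"
  have one: "\<kappa> x = 1" if "norm x < B + 1" for x
  proof -
    have "norm (convolution \<rho> c x - 1) \<le> 0"
    proof (rule convolution_mollifier_bound[OF \<rho> c(1)])
      fix y :: "real^'n" assume "norm y < 1"
      then have "norm (x - y) \<le> B + 2" using that norm_triangle_ineq4[of x y] by linarith
      then show "norm (c (x - y) - 1) \<le> 0" by (simp add: c_def)
    qed
    then show ?thesis by (simp add: \<kappa>_def)
  qed
  show thesis
  proof (rule that)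
    show "\<kappa> \<in> test_functions"
      unfolding \<kappa>_def by (rule convolution_mollifier_test_function[OF \<rho> c])
    show "\<kappa> x = 1" if "x \<in> K" for x using B[OF that] one by simp
    show "gradient \<kappa> x = 0" if "x \<in> K" for x
    proof -
      have "gradient \<kappa> x = gradient (\<lambda>_. 1) x"
        by (rule gradient_cong_open[of "ball 0 (B + 1)"]) (use B[OF that] one in auto)
      then show ?thesis by simp
    qed
  qed
qed

lemma distribution_linear:
  assumes f: "distribution f" and \<phi>: "\<phi> \<in> test_functions" and \<psi>: "\<psi> \<in> test_functions"
  shows "f (\<lambda>x. a * \<phi> x + b * \<psi> x) = a * f \<phi> + b * f \<psi>"
proof -
  have scale: "(\<lambda>x. c * \<eta> x) \<in> test_functions" if "\<eta> \<in> test_functions" for c \<eta>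
    using test_functions_linear_combination[OF that that, of c 0] by simp
  show ?thesis
    using f scale[OF \<phi>, of a] scale[OF \<psi>, of b] \<phi> \<psi> by (simp add: distribution_def)
qed

text \<open>Real suprema are meaningful only for nonempty sets that are bounded above;
  \<open>B\<close> secures the lower estimate as well.\<close>

lemma sup_norm_on_bounds:
  assumes "S \<noteq> {}" "\<And>x. x \<in> S \<Longrightarrow> norm (g x) \<le> B"
  shows "0 \<le> sup_norm_on S g" "sup_norm_on S g \<le> B"
proof -
  obtain x where x: "x \<in> S" using assms by blast
  have "norm (g x) \<le> sup_norm_on S g"
    unfolding sup_norm_on_def using assms x by (intro cSUP_upper) (auto intro!: bdd_aboveI2)
  then show "0 \<le> sup_norm_on S g" by (rule order_trans[OF norm_ge_zero])
  show "sup_norm_on S g \<le> B"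
    unfolding sup_norm_on_def using assms by (intro cSUP_least)
qed

lemma convex_gradient_lipschitz:
  assumes "convex S" "\<And>x. x \<in> S \<Longrightarrow> \<phi> differentiable (at x)" "\<And>x. x \<in> S \<Longrightarrow> norm (gradient \<phi> x) \<le> B"
    and "x \<in> S" "y \<in> S"
  shows "\<bar>\<phi> x - \<phi> y\<bar> \<le> B * norm (x - y)"
proof -
  have "norm (\<phi> x - \<phi> y) \<le> B * norm (x - y)"
  proof (rule differentiable_bound[OF assms(1) _ _ assms(4,5), where f'="\<lambda>x v. gradient \<phi> x \<bullet> v"])
    fix z assume z: "z \<in> S"
    show "(\<phi> has_derivative (\<lambda>v. gradient \<phi> z \<bullet> v)) (at z within S)"
      using has_derivative_gradient[OF assms(2)[OF z]] by (rule has_derivative_at_withinI)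
    show "onorm (\<lambda>v. gradient \<phi> z \<bullet> v) \<le> B"
    proof (rule onorm_le)
      show "norm (gradient \<phi> z \<bullet> v) \<le> B * norm v" for v
        unfolding real_norm_def
        by (rule order_trans[OF Cauchy_Schwarz_ineq2 mult_right_mono]) (use assms(3)[OF z] in auto)
    qed
  qed
  then show ?thesis by simp
qed

text \<open>This isolates what is used of membership in \<open>X0\<close>. Quantifying over every
  admissible \<open>B\<close>, instead of naming a supremum, covers empty \<Omega>: there negative
  \<open>B\<close> are admissible and force \<open>C = 0\<close>.\<close>

locale gradient_bounded_functional =
  fixes \<Omega> :: "(real^'n) set" and f :: "(real^'n \<Rightarrow> real) \<Rightarrow> real" and C :: real
  assumes C_nonneg: "C \<ge> 0"
    and linear: "\<phi> \<in> test_functions \<Longrightarrow> \<psi> \<in> test_functions \<Longrightarrow> f (\<lambda>x. a * \<phi> x + b * \<psi> x) = a * f \<phi> + b * f \<psi>"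
    and bound: "\<phi> \<in> test_functions \<Longrightarrow> (\<And>x. x \<in> \<Omega> \<Longrightarrow> norm (gradient \<phi> x) \<le> B) \<Longrightarrow> \<bar>f \<phi>\<bar> \<le> C * B"

text \<open>Subtracting a multiple of a cutoff normalizes the test function to vanish at a point of
  \<open>\<Omega>\<close>; this is where \<open>\<langle>f, 1\<rangle> = 0\<close> enters.\<close>

lemma X0_gradient_bounded:
  fixes \<Omega> :: "(real^'n) set"
  assumes \<Omega>: "convex \<Omega>" "compact \<Omega>" and f: "f \<in> X0 \<Omega>"
  obtains C where "gradient_bounded_functional \<Omega> f C"
proof -
  obtain C0 where dist: "distribution f"
    and C0: "\<And>\<phi>. \<phi> \<in> test_functions \<Longrightarrow> f \<phi> \<le> C0 * (sup_norm_on \<Omega> \<phi> + sup_norm_on \<Omega> (gradient \<phi>))"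
    and const: "\<And>\<phi>. \<phi> \<in> test_functions \<Longrightarrow> \<phi> constant_on \<Omega> \<Longrightarrow> f \<phi> = 0"
    using f by (auto simp: X0_def)
  note lin = distribution_linear[OF dist]
  show thesis
  proof (cases "\<Omega> = {}")
    case True
    then have "f \<phi> = 0" if "\<phi> \<in> test_functions" for \<phi>
      using const[OF that] by (simp add: constant_on_def)
    then have "gradient_bounded_functional \<Omega> f 0"
      by unfold_locales (use lin in auto)
    then show thesis by (rule that)
  next
    case False
    then obtain x0 where x0: "x0 \<in> \<Omega>" by blast
    obtain \<kappa> where \<kappa>: "\<kappa> \<in> test_functions" "\<And>x. x \<in> \<Omega> \<Longrightarrow> \<kappa> x = 1" "\<And>x. x \<in> \<Omega> \<Longrightarrow> gradient \<kappa> x = 0"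
      using cutoff_exists[OF compact_imp_bounded[OF \<Omega>(2)]] by blast
    have f\<kappa>: "f \<kappa> = 0" using const[OF \<kappa>(1)] \<kappa>(2) by (auto simp: constant_on_def)
    define D where "D = diameter \<Omega>"
    have D: "D \<ge> 0" "\<And>x. x \<in> \<Omega> \<Longrightarrow> norm (x - x0) \<le> D"
      using diameter_ge_0[OF compact_imp_bounded[OF \<Omega>(2)]] diameter_bounded_bound[OF compact_imp_bounded[OF \<Omega>(2)] _ x0]
      by (auto simp: D_def dist_norm)
    \<comment> \<open>\<open>D\<close> pays for the values of the normalized function, which
      vanishes at \<open>x0\<close> and is Lipschitz on the convex set \<Omega>; 1 pays for its
      gradient. The maximum is taken because \<open>C0\<close> may be negative.\<close>
    define C where "C = max C0 0 * (D + 1)"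
    have upper: "f \<phi> \<le> C * B" if \<phi>: "\<phi> \<in> test_functions" and B: "\<And>x. x \<in> \<Omega> \<Longrightarrow> norm (gradient \<phi> x) \<le> B" for \<phi> B
    proof -
      have B0: "B \<ge> 0" using B[OF x0] norm_ge_zero order_trans by blast
      define \<psi> where "\<psi> x = 1 * \<phi> x + (- \<phi> x0) * \<kappa> x" for x
      have \<psi>: "\<psi> \<in> test_functions"
        unfolding \<psi>_def using \<phi> \<kappa>(1) by (rule test_functions_linear_combination)
      have d: "\<phi> differentiable (at x)" "\<kappa> differentiable (at x)" for x
        using \<phi> \<kappa>(1) by (auto simp: test_functions_def smooth_differentiable)
      have "norm (\<psi> x) \<le> B * D" if x: "x \<in> \<Omega>" for x
      proof -
        have "\<bar>\<phi> x - \<phi> x0\<bar> \<le> B * norm (x - x0)"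
          using convex_gradient_lipschitz[OF \<Omega>(1) d(1) B x x0] .
        also have "\<dots> \<le> B * D" using D(2)[OF x] B0 by (rule mult_left_mono)
        finally show ?thesis using x by (simp add: \<psi>_def \<kappa>(2))
      qed
      note s1 = sup_norm_on_bounds[where g=\<psi>, OF False this]
      have "norm (gradient \<psi> x) \<le> B" if x: "x \<in> \<Omega>" for x
        unfolding \<psi>_def gradient_linear_combination[OF d] using B[OF x] \<kappa>(3)[OF x] by simp
      note s2 = sup_norm_on_bounds[where g="gradient \<psi>", OF False this]
      have "f \<phi> = f \<psi>"
        unfolding \<psi>_def lin[OF \<phi> \<kappa>(1)] f\<kappa> by simp
      also have "\<dots> \<le> C0 * (sup_norm_on \<Omega> \<psi> + sup_norm_on \<Omega> (gradient \<psi>))"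
        by (rule C0[OF \<psi>])
      also have "\<dots> \<le> max C0 0 * (sup_norm_on \<Omega> \<psi> + sup_norm_on \<Omega> (gradient \<psi>))"
        using s1 s2 by (intro mult_right_mono) auto
      also have "\<dots> \<le> max C0 0 * (B * D + B)"
        using s1 s2 by (intro mult_left_mono) auto
      finally show ?thesis by (simp add: C_def algebra_simps)
    qed
    have "gradient_bounded_functional \<Omega> f C"
    proof
      show "C \<ge> 0" using D by (simp add: C_def)
      show "\<bar>f \<phi>\<bar> \<le> C * B" if \<phi>: "\<phi> \<in> test_functions" and B: "\<And>x. x \<in> \<Omega> \<Longrightarrow> norm (gradient \<phi> x) \<le> B" for \<phi> B
      proof -
        \<comment> \<open>The estimate in \<open>X0\<close> is one-sided; applying it to
          \<open>- \<phi>\<close> supplies the absolute value. The zero term only gives the shape of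
          a linear combination.\<close>
        let ?m = "\<lambda>x. (-1) * \<phi> x + 0 * \<phi> x"
        have d: "\<phi> differentiable (at x)" for x
          using \<phi> by (auto simp: test_functions_def smooth_differentiable)
        have "f ?m \<le> C * B"
          using B by (intro upper test_functions_linear_combination \<phi>) (simp only: gradient_linear_combination[OF d d], simp)
        then show ?thesis
          using upper[OF \<phi> B] unfolding lin[OF \<phi> \<phi>] by (simp add: abs_le_iff)
      qed
    qed (rule lin)
    then show thesis by (rule that)
  qed
qed

section \<open>Extension to compactly supported C1 functions\<close>

lemma test_functions_dense:
  fixes \<phi> :: "real^'n \<Rightarrow> real"
  assumes \<phi>: "\<phi> \<in> C1_compact" and e: "e > 0"
  obtains \<psi> where "\<psi> \<in> test_functions" "\<And>x. \<bar>\<psi> x - \<phi> x\<bar> \<le> e" "\<And>x. norm (gradient \<psi> x - gradient \<phi> x) \<le> e"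
proof -
  obtain d where d: "d > 0" "\<And>r (\<rho> :: real^'n \<Rightarrow> real) x. r \<le> d \<Longrightarrow> mollifier r \<rho> \<Longrightarrow>
    \<bar>convolution \<rho> \<phi> x - \<phi> x\<bar> \<le> e \<and> norm (gradient (convolution \<rho> \<phi>) x - gradient \<phi> x) \<le> e"
    using mollification_approximates[OF assms] by blast
  obtain \<rho> :: "real^'n \<Rightarrow> real" where \<rho>: "mollifier d \<rho>" using ex_mollifier[OF d(1)] by blast
  obtain R where "\<And>x. R < norm x \<Longrightarrow> \<phi> x = 0" using C1_compactD(5)[OF \<phi>] by blast
  then have "convolution \<rho> \<phi> \<in> test_functions"
    by (rule convolution_mollifier_test_function[OF \<rho> C1_compactD(3)[OF \<phi>]])
  then show thesis using d(2)[OF order_refl \<rho>] by (intro that) auto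
qed

context gradient_bounded_functional
begin

lemma bound_diff:
  assumes "\<phi> \<in> test_functions" "\<psi> \<in> test_functions" "\<And>x. x \<in> \<Omega> \<Longrightarrow> norm (gradient \<phi> x - gradient \<psi> x) \<le> B"
  shows "\<bar>f \<phi> - f \<psi>\<bar> \<le> C * B"
proof -
  have "\<bar>f (\<lambda>x. 1 * \<phi> x + (-1) * \<psi> x)\<bar> \<le> C * B"
    using assms by (intro bound test_functions_linear_combination)
      (simp_all add: gradient_linear_combination[where a=1 and b="-1", simplified] C1_compactD(1) test_functions_C1_compact)
  then show ?thesis unfolding linear[OF assms(1,2)] by simp
qed

text \<open>The limit is characterized by an error bound in terms of gradients on \<Omega>, not just
  by convergence along one sequence; the later properties of the extension are read off from this
  bound.\<close>

lemma limit_exists: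
  assumes \<phi>: "\<phi> \<in> C1_compact"
  obtains L where "\<And>\<psi> B. \<psi> \<in> test_functions \<Longrightarrow> (\<And>x. x \<in> \<Omega> \<Longrightarrow> norm (gradient \<psi> x - gradient \<phi> x) \<le> B) \<Longrightarrow>
    \<bar>f \<psi> - L\<bar> \<le> C * B"
proof -
  have "\<exists>\<psi>\<in>test_functions. \<forall>x. norm (gradient \<psi> x - gradient \<phi> x) \<le> 1 / Suc k" for k
    using test_functions_dense[OF \<phi>, of "1 / Suc k"] by (metis of_nat_0_less_iff zero_less_Suc zero_less_divide_1_iff)
  then obtain \<Psi> where \<Psi>: "\<And>k. \<Psi> k \<in> test_functions" "\<And>k x. norm (gradient (\<Psi> k) x - gradient \<phi> x) \<le> 1 / Suc k"
    by metis
  have lim1: "(\<lambda>k. C * (B + 1 / Suc k)) \<longlonglongrightarrow> C * (B + 0)" for B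
    by (intro tendsto_intros LIMSEQ_Suc[OF lim_1_over_n])
  have close: "\<bar>f \<psi> - f (\<Psi> k)\<bar> \<le> C * (B + 1 / Suc k)"
    if "\<psi> \<in> test_functions" "\<And>x. x \<in> \<Omega> \<Longrightarrow> norm (gradient \<psi> x - gradient \<phi> x) \<le> B" for \<psi> B k
  proof (rule bound_diff[OF that(1) \<Psi>(1)])
    fix x assume "x \<in> \<Omega>"
    then show "norm (gradient \<psi> x - gradient (\<Psi> k) x) \<le> B + 1 / Suc k"
      using norm_triangle_le_diff[of "gradient \<psi> x - gradient \<phi> x" "gradient (\<Psi> k) x - gradient \<phi> x"] that(2) \<Psi>(2)[of k x]
      by (smt (verit) add_diff_cancel_left' diff_add_cancel norm_triangle_ineq4 diff_diff_eq2)
  qed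
  have "Cauchy (\<lambda>k. f (\<Psi> k))"
  proof (rule metric_CauchyI)
    fix e :: real assume "e > 0"
    moreover have "(\<lambda>k. C * (1 / Suc k + 1 / Suc k)) \<longlonglongrightarrow> C * (0 + 0)"
      by (intro tendsto_intros LIMSEQ_Suc[OF lim_1_over_n])
    ultimately have "\<forall>\<^sub>F k in sequentially. C * (1 / Suc k + 1 / Suc k) < e"
      by (intro order_tendstoD(2)[where y="C * (0 + 0)"]) auto
    then obtain N where N: "C * (1 / Suc N + 1 / Suc N) < e" 
      by (auto simp: eventually_sequentially)
    have "dist (f (\<Psi> m)) (f (\<Psi> n)) < e" if "m \<ge> N" "n \<ge> N" for m n
    proof -
      have mono: "1 / Suc k \<le> (1 / Suc N :: real)" if "k \<ge> N" for k
        using that by (intro divide_left_mono) auto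
      have "\<bar>f (\<Psi> m) - f (\<Psi> n)\<bar> \<le> C * (1 / Suc N + 1 / Suc n)"
        using mono[OF that(1)] \<Psi>(2) by (intro close \<Psi>) (meson order_trans)
      also have "\<dots> \<le> C * (1 / Suc N + 1 / Suc N)"
        using mono[OF that(2)] C_nonneg by (intro mult_left_mono) auto
      finally show ?thesis using N by (simp add: dist_real_def)
    qed
    then show "\<exists>M. \<forall>m\<ge>M. \<forall>n\<ge>M. dist (f (\<Psi> m)) (f (\<Psi> n)) < e" by blast
  qed
  then obtain L where L: "(\<lambda>k. f (\<Psi> k)) \<longlonglongrightarrow> L"
    using Cauchy_convergent_iff convergent_def by blast
  show thesis
  proof (rule that[of L])
    fix \<psi> B assume *: "\<psi> \<in> test_functions" "\<And>x. x \<in> \<Omega> \<Longrightarrow> norm (gradient \<psi> x - gradient \<phi> x) \<le> B"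
    have "(\<lambda>k. \<bar>f \<psi> - f (\<Psi> k)\<bar>) \<longlonglongrightarrow> \<bar>f \<psi> - L\<bar>"
      using L by (intro tendsto_intros)
    from LIMSEQ_le[OF this lim1[of B]] close[OF *]
    show "\<bar>f \<psi> - L\<bar> \<le> C * B" by auto
  qed
qed

lemma C1_extension_approx:
  assumes \<phi>: "\<phi> \<in> C1_compact" and "\<psi> \<in> test_functions"
    and "\<And>x. x \<in> \<Omega> \<Longrightarrow> norm (gradient \<psi> x - gradient \<phi> x) \<le> B"
  shows "\<bar>f \<psi> - C1_extension f \<phi>\<bar> \<le> C * B"
proof -
  obtain L where L: "\<And>\<psi> B. \<psi> \<in> test_functions \<Longrightarrow> (\<And>x. x \<in> \<Omega> \<Longrightarrow> norm (gradient \<psi> x - gradient \<phi> x) \<le> B) \<Longrightarrow>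
    \<bar>f \<psi> - L\<bar> \<le> C * B"
    using limit_exists[OF \<phi>] by blast
  have conv: "(\<lambda>k. f (\<psi> k)) \<longlonglongrightarrow> L" 
    if \<psi>: "\<forall>k. \<psi> k \<in> test_functions" and u: "uniform_limit UNIV (\<lambda>k. gradient (\<psi> k)) (gradient \<phi>) sequentially" for \<psi>
  proof (rule tendstoI)
    fix e :: real assume e: "e > 0"
    have "\<forall>\<^sub>F k in sequentially. \<forall>x\<in>UNIV. dist (gradient (\<psi> k) x) (gradient \<phi> x) < e / (C + 1)"
      using C_nonneg e by (intro uniform_limitD[OF u]) auto
    then show "\<forall>\<^sub>F k in sequentially. dist (f (\<psi> k)) L < e"
    proof eventually_elim
      case (elim k)
      have "\<bar>f (\<psi> k) - L\<bar> \<le> C * (e / (C + 1))"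
        using \<psi> elim by (intro L) (auto simp: dist_norm intro: less_imp_le)
      also have "\<dots> = e * (C / (C + 1))" by simp
      also have "\<dots> < e * 1" using C_nonneg e by (intro mult_strict_left_mono) auto
      finally show ?case by (simp add: dist_real_def)
    qed
  qed
  have "\<exists>\<psi>\<in>test_functions. \<forall>x. \<bar>\<psi> x - \<phi> x\<bar> \<le> 1 / Suc k \<and> norm (gradient \<psi> x - gradient \<phi> x) \<le> 1 / Suc k" for k
    using test_functions_dense[OF \<phi>, of "1 / Suc k"] by (metis of_nat_0_less_iff zero_less_Suc zero_less_divide_1_iff)
  then obtain \<Psi> where \<Psi>: "\<forall>k. \<Psi> k \<in> test_functions" 
    "\<And>k x. \<bar>\<Psi> k x - \<phi> x\<bar> \<le> 1 / Suc k" "\<And>k x. norm (gradient (\<Psi> k) x - gradient \<phi> x) \<le> 1 / Suc k"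
    by metis
  have ul: "uniform_limit UNIV g h sequentially" if "\<And>k x. dist (g k x) (h x) \<le> 1 / Suc k"
    for g and h :: "real^'n \<Rightarrow> 'b::metric_space"
  proof (rule uniform_limitI)
    fix e :: real assume "e > 0"
    then have "\<forall>\<^sub>F k in sequentially. 1 / real (Suc k) < e"
      by (rule order_tendstoD(2)[OF LIMSEQ_Suc[OF lim_1_over_n]])
    then show "\<forall>\<^sub>F k in sequentially. \<forall>x\<in>UNIV. dist (g k x) (h x) < e"
      by eventually_elim (use that le_less_trans in blast)
  qed
  have "C1_extension f \<phi> = L"
    unfolding C1_extension_def
  proof (rule the_equality)
    show "\<forall>\<psi>. (\<forall>k. \<psi> k \<in> test_functions) \<longrightarrow> uniform_limit UNIV \<psi> \<phi> sequentially \<longrightarrow>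
       uniform_limit UNIV (\<lambda>k. gradient (\<psi> k)) (gradient \<phi>) sequentially \<longrightarrow> (\<lambda>k. f (\<psi> k)) \<longlonglongrightarrow> L"
      using conv by blast
    fix l assume l: "\<forall>\<psi>. (\<forall>k. \<psi> k \<in> test_functions) \<longrightarrow> uniform_limit UNIV \<psi> \<phi> sequentially \<longrightarrow>
       uniform_limit UNIV (\<lambda>k. gradient (\<psi> k)) (gradient \<phi>) sequentially \<longrightarrow> (\<lambda>k. f (\<psi> k)) \<longlonglongrightarrow> l"
    \<comment> \<open>The condition defining \<open>C1_extension\<close> is an implication about
      approximating sequences, so uniqueness of \<open>l\<close> requires that at least one
      exists.\<close>
    have u: "uniform_limit UNIV \<Psi> \<phi> sequentially" "uniform_limit UNIV (\<lambda>k. gradient (\<Psi> k)) (gradient \<phi>) sequentially"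
      using \<Psi>(2,3) by (auto intro!: ul simp: dist_norm simp del: of_nat_Suc)
    then have "(\<lambda>k. f (\<Psi> k)) \<longlonglongrightarrow> l" using l \<Psi>(1) by blast
    then show "l = L" using conv[OF \<Psi>(1) u(2)] LIMSEQ_unique by blast
  qed
  then show ?thesis using L[OF assms(2,3)] by simp
qed

lemma C1_extension_bound:
  assumes \<phi>: "\<phi> \<in> C1_compact" and B: "\<And>x. x \<in> \<Omega> \<Longrightarrow> norm (gradient \<phi> x) \<le> B"
  shows "\<bar>C1_extension f \<phi>\<bar> \<le> C * B"
proof (rule field_le_epsilon)
  fix e :: real assume e: "e > 0"
  \<comment> \<open>Two errors of size \<open>C * e'\<close> occur below, from the extension and
    from the enlarged gradient bound.\<close>
  define e' where "e' = e / (2 * (C + 1))"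
  have e': "e' > 0" using e C_nonneg by (simp add: e'_def)
  obtain \<psi> where \<psi>: "\<psi> \<in> test_functions" "\<And>x. norm (gradient \<psi> x - gradient \<phi> x) \<le> e'"
    using test_functions_dense[OF \<phi> e'] by metis
  have "norm (gradient \<psi> x) \<le> B + e'" if "x \<in> \<Omega>" for x
    using norm_triangle_sub[of "gradient \<psi> x" "gradient \<phi> x"] B[OF that] \<psi>(2)[of x] by linarith
  then have "\<bar>f \<psi>\<bar> \<le> C * (B + e')" by (rule bound[OF \<psi>(1)])
  moreover have "\<bar>f \<psi> - C1_extension f \<phi>\<bar> \<le> C * e'"
    by (rule C1_extension_approx[OF \<phi> \<psi>])
  moreover have "2 * (C * e') \<le> e"
    using C_nonneg e by (simp add: e'_def field_simps)
  ultimately show "\<bar>C1_extension f \<phi>\<bar> \<le> C * B + e"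
    by (simp add: algebra_simps)
qed

lemma C1_extension_0: "C1_extension f (\<lambda>_. 0) = 0"
  using C1_extension_bound[OF test_functions_C1_compact[OF zero_test_function], of 0] by simp

text \<open>The three extension values are replaced by values of \<open>f\<close> at test functions,
  where linearity is given; the total error is a fixed multiple \<open>?K\<close> of an arbitrary
  \<open>e\<close>.\<close>

lemma C1_extension_linear:
  assumes \<phi>: "\<phi> \<in> C1_compact" and \<psi>: "\<psi> \<in> C1_compact"
  shows "C1_extension f (\<lambda>x. a * \<phi> x + b * \<psi> x) = a * C1_extension f \<phi> + b * C1_extension f \<psi>"
proof -
  let ?\<eta> = "\<lambda>x. a * \<phi> x + b * \<psi> x"
  let ?err = "\<bar>C1_extension f ?\<eta> - (a * C1_extension f \<phi> + b * C1_extension f \<psi>)\<bar>"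
  let ?K = "C * (\<bar>a\<bar> + \<bar>b\<bar>) + \<bar>a\<bar> * C + \<bar>b\<bar> * C"
  have "?err \<le> ?K * e" if e: "e > 0" for e
  proof -
    obtain p where p: "p \<in> test_functions" "\<And>x. norm (gradient p x - gradient \<phi> x) \<le> e"
      using test_functions_dense[OF \<phi> e] by metis
    obtain q where q: "q \<in> test_functions" "\<And>x. norm (gradient q x - gradient \<psi> x) \<le> e"
      using test_functions_dense[OF \<psi> e] by metis
    note d = C1_compactD(1)[OF \<phi>] C1_compactD(1)[OF \<psi>]
      C1_compactD(1)[OF test_functions_C1_compact[OF p(1)]] C1_compactD(1)[OF test_functions_C1_compact[OF q(1)]]
    have "\<bar>f (\<lambda>x. a * p x + b * q x) - C1_extension f ?\<eta>\<bar> \<le> C * ((\<bar>a\<bar> + \<bar>b\<bar>) * e)"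
    proof (intro C1_extension_approx C1_compact_linear_combination test_functions_linear_combination \<phi> \<psi> p q)
      fix x
      have "gradient (\<lambda>x. a * p x + b * q x) x - gradient ?\<eta> x
          = a *\<^sub>R (gradient p x - gradient \<phi> x) + b *\<^sub>R (gradient q x - gradient \<psi> x)"
        by (simp add: gradient_linear_combination d algebra_simps)
      also have "norm \<dots> \<le> \<bar>a\<bar> * e + \<bar>b\<bar> * e"
        using p(2)[of x] q(2)[of x] by (intro norm_triangle_le add_mono) (auto intro: mult_left_mono)
      finally show "norm (gradient (\<lambda>x. a * p x + b * q x) x - gradient ?\<eta> x) \<le> (\<bar>a\<bar> + \<bar>b\<bar>) * e"
        by (simp add: algebra_simps)
    qed
    moreover have "\<bar>a * f p - a * C1_extension f \<phi>\<bar> \<le> \<bar>a\<bar> * (C * e)"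
      using C1_extension_approx[OF \<phi> p] by (simp add: mult_left_mono abs_mult flip: right_diff_distrib)
    moreover have "\<bar>b * f q - b * C1_extension f \<psi>\<bar> \<le> \<bar>b\<bar> * (C * e)"
      using C1_extension_approx[OF \<psi> q] by (simp add: mult_left_mono abs_mult flip: right_diff_distrib)
    ultimately have "?err \<le> C * ((\<bar>a\<bar> + \<bar>b\<bar>) * e) + \<bar>a\<bar> * (C * e) + \<bar>b\<bar> * (C * e)"
      unfolding linear[OF p(1) q(1)] by linarith
    then show ?thesis by (simp add: algebra_simps)
  qed
  note est = this
  have K: "?K \<ge> 0" using C_nonneg by simp
  have "?err \<le> 0 + e" if e: "e > 0" for e
  proof -
    have "?err \<le> ?K * (e / (?K + 1))"
      using e K by (intro est divide_pos_pos) auto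
    also have "\<dots> = e * (?K / (?K + 1))" by simp
    also have "\<dots> \<le> e * 1" using e K by (intro mult_left_mono) auto
    finally show ?thesis by simp
  qed
  then have "?err \<le> 0" by (rule field_le_epsilon)
  then show ?thesis by simp
qed

end

section \<open>Extending a gradient bound beyond a convex set\<close>

text \<open>Differentiating along \<open>g = gradient \<phi> x\<close> itself gives
  \<open>g \<bullet> g \<le> L * norm g\<close>.\<close>

lemma gradient_norm_le_lipschitz:
  fixes \<phi> :: "real^'n \<Rightarrow> real"
  assumes d: "\<phi> differentiable (at x)" and L: "L \<ge> 0" "\<And>y. \<bar>\<phi> y - \<phi> x\<bar> \<le> L * norm (y - x)"
  shows "norm (gradient \<phi> x) \<le> L"
proof -
  define g where "g = gradient \<phi> x"
  have "((\<lambda>t. x + t *\<^sub>R g) has_derivative (\<lambda>t. t *\<^sub>R g)) (at 0)"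
    by (auto intro!: derivative_eq_intros)
  moreover have "(\<phi> has_derivative (\<lambda>v. g \<bullet> v)) (at (x + 0 *\<^sub>R g))"
    using has_derivative_gradient[OF d] by (simp add: g_def)
  ultimately have "((\<lambda>t. \<phi> (x + t *\<^sub>R g)) has_derivative (\<lambda>t. g \<bullet> (t *\<^sub>R g))) (at 0)"
    by (rule has_derivative_compose)
  then have "((\<lambda>t. \<phi> (x + t *\<^sub>R g)) has_real_derivative g \<bullet> g) (at 0)"
    by (simp add: has_field_derivative_def mult.commute[of _ "g \<bullet> g"])
  then have "((\<lambda>t. (\<phi> (x + t *\<^sub>R g) - \<phi> x) / t) \<longlongrightarrow> g \<bullet> g) (at 0)"
    by (simp add: DERIV_def)
  then have "g \<bullet> g \<le> L * norm g"
  proof (rule tendsto_upperbound)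
    have "(\<phi> (x + t *\<^sub>R g) - \<phi> x) / t \<le> L * norm g" if "t \<noteq> 0" for t
    proof -
      have "(\<phi> (x + t *\<^sub>R g) - \<phi> x) / t \<le> \<bar>\<phi> (x + t *\<^sub>R g) - \<phi> x\<bar> / \<bar>t\<bar>"
        by (metis abs_divide abs_ge_self)
      also have "\<dots> \<le> (L * (\<bar>t\<bar> * norm g)) / \<bar>t\<bar>"
        using L(2)[of "x + t *\<^sub>R g"] by (intro divide_right_mono) simp_all
      finally show ?thesis using that by simp
    qed
    then show "\<forall>\<^sub>F t in at 0. (\<phi> (x + t *\<^sub>R g) - \<phi> x) / t \<le> L * norm g"
      using eventually_neq_at_within by (rule eventually_mono[rotated])
  qed simp
  then have "norm g * norm g \<le> L * norm g"
    by (simp add: dot_square_norm power2_eq_square)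
  then show ?thesis
    using L(1) by (cases "norm g = 0") (auto simp: g_def)
qed

text \<open>The difference of the two values is the convolution of \<open>\<rho>\<close> with a
  difference of translates of \<open>g\<close>, which is at most \<open>L * norm (y - x)\<close>
  everywhere.\<close>

lemma convolution_lipschitz:
  fixes g :: "real^'n \<Rightarrow> real"
  assumes \<rho>: "mollifier r \<rho>" and g: "continuous_on UNIV g" "\<And>x y. \<bar>g y - g x\<bar> \<le> L * norm (y - x)"
  shows "\<bar>convolution \<rho> g y - convolution \<rho> g x\<bar> \<le> L * norm (y - x)"
proof -
  define h where "h z = g (z + (y - x)) - g z" for z
  have h: "continuous_on UNIV h"
    unfolding h_def by (intro continuous_intros continuous_on_compose2[OF g(1)] g(1)) auto
  have int: "integrable lborel (\<lambda>z. \<rho> z *\<^sub>R g (x - z))" for x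
    by (rule convolution_integrable[OF mollifierD(1,2)[OF \<rho>] g(1)])
  have "convolution \<rho> h x = (\<integral>z. \<rho> z *\<^sub>R g (y - z) - \<rho> z *\<^sub>R g (x - z) \<partial>lborel)"
    unfolding convolution_def h_def by (intro Bochner_Integration.integral_cong) (simp_all add: algebra_simps)
  also have "\<dots> = convolution \<rho> g y - convolution \<rho> g x"
    using int by (simp add: convolution_def)
  finally have "convolution \<rho> h x = convolution \<rho> g y - convolution \<rho> g x" .
  moreover have "norm (convolution \<rho> h x - 0) \<le> L * norm (y - x)"
  proof (rule convolution_mollifier_bound[OF \<rho> h])
    show "norm (h (x - w) - 0) \<le> L * norm (y - x)" for w
      using g(2)[of "x - w + (y - x)" "x - w"] by (simp add: h_def)
  qed
  ultimately show ?thesis by simp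
qed

text \<open>On a thickened \<open>\<Omega>\<close> the gradient bound persists up to \<open>e\<close>; composing with the nearest-point
  projection makes it global, clamping by a cone restores compact support without increasing the
  Lipschitz constant, and mollification does not change the gradient on \<open>\<Omega>\<close> much.\<close>

lemma global_gradient_bound_approx:
  fixes \<phi> :: "real^'n \<Rightarrow> real"
  assumes \<Omega>: "convex \<Omega>" "compact \<Omega>" "\<Omega> \<noteq> {}" and \<phi>: "\<phi> \<in> C1_compact"
    and M: "M \<ge> 0" "\<And>x. x \<in> \<Omega> \<Longrightarrow> norm (gradient \<phi> x) \<le> M" and e: "e > 0"
  obtains u where "u \<in> test_functions" "\<And>x. norm (gradient u x) \<le> M + e"
    "\<And>x. x \<in> \<Omega> \<Longrightarrow> norm (gradient u x - gradient \<phi> x) \<le> e"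
proof -
  obtain R0 where R0: "\<And>x. R0 < norm x \<Longrightarrow> \<phi> x = 0" "\<And>x. R0 < norm x \<Longrightarrow> gradient \<phi> x = 0"
    using C1_compactD(5)[OF \<phi>] by blast
  obtain d where d: "d > 0" "\<And>x y. norm (x - y) < d \<Longrightarrow> norm (gradient \<phi> x - gradient \<phi> y) < e"
    using uniformly_continuous_compact_supp[OF C1_compactD(4)[OF \<phi>] R0(2) e] by blast
  define L where "L = M + e"
  have L: "L > 0" using M e by (simp add: L_def)
  define \<delta> where "\<delta> = d / 2"
  have \<delta>: "0 < \<delta>" "\<delta> < d" using d by (auto simp: \<delta>_def)
  \<comment> \<open>As a Minkowski sum with a closed ball the thickening is again compact and
    convex. Projecting to it rather than to \<Omega> leaves \<open>\<phi>\<close> unchanged on a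
    neighbourhood of \<Omega>, hence also its gradient there.\<close>
  define S where "S = {x + y | x y. x \<in> \<Omega> \<and> y \<in> cball 0 \<delta>}"
  have S: "compact S" "convex S" "S \<noteq> {}"
  proof -
    show "compact S" unfolding S_def using \<Omega>(2) compact_cball by (rule compact_sums)
    have "S = (\<Union>x\<in>\<Omega>. \<Union>y\<in>cball 0 \<delta>. {x + y})" unfolding S_def by blast
    then show "convex S" using convex_sums[OF \<Omega>(1) convex_cball] by simp
    obtain x where "x \<in> \<Omega>" using \<Omega>(3) by blast
    then have "x + 0 \<in> S"
      unfolding S_def using \<delta>(1) by (intro CollectI exI[of _ x] exI[of _ 0]) auto
    then show "S \<noteq> {}" by blast
  qed
  have in_S: "y \<in> S" if "x \<in> \<Omega>" "norm (y - x) \<le> \<delta>" for x y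
    unfolding S_def using that by (intro CollectI exI[of _ x] exI[of _ "y - x"]) auto
  have grad_S: "norm (gradient \<phi> y) \<le> L" if "y \<in> S" for y
  proof -
    obtain x z where "x \<in> \<Omega>" "norm z \<le> \<delta>" "y = x + z"
      using \<open>y \<in> S\<close> by (auto simp: S_def)
    then have x: "x \<in> \<Omega>" "norm (y - x) \<le> \<delta>" by auto
    then have "norm (gradient \<phi> y - gradient \<phi> x) < e" using d(2)[of y x] \<delta> by simp
    then show ?thesis
      using norm_triangle_sub[of "gradient \<phi> y" "gradient \<phi> x"] M(2)[OF x(1)] by (simp add: L_def)
  qed
  define g0 where "g0 y = \<phi> (closest_point S y)" for y
  have S_cl: "closed S" using S(1) by (rule compact_imp_closed)
  have g0_lip: "\<bar>g0 y - g0 x\<bar> \<le> L * norm (y - x)" for x y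
  proof -
    have "\<bar>g0 y - g0 x\<bar> \<le> L * norm (closest_point S y - closest_point S x)"
      unfolding g0_def
      by (rule convex_gradient_lipschitz[OF S(2) C1_compactD(1)[OF \<phi>] grad_S])
         (simp_all add: closest_point_in_set[OF S_cl S(3)])
    also have "\<dots> \<le> L * norm (y - x)"
      using closest_point_lipschitz[OF S(2) S_cl S(3), of y x] L by (simp add: dist_norm)
    finally show ?thesis .
  qed
  have "bounded (\<phi> ` cball 0 (max R0 0))"
    using continuous_on_subset[OF C1_compactD(3)[OF \<phi>]]
    by (intro compact_imp_bounded compact_continuous_image) auto
  then obtain b where b: "\<forall>x\<in>cball 0 (max R0 0). \<bar>\<phi> x\<bar> \<le> b"
    unfolding bounded_iff ball_simps real_norm_def ..
  have b: "\<bar>\<phi> x\<bar> \<le> b" for x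
    using b[rule_format, of x] b[rule_format, of 0] R0(1)[of x] by (cases "norm x \<le> max R0 0") auto
  obtain s where s: "\<And>x. x \<in> S \<Longrightarrow> norm x \<le> s"
    using compact_imp_bounded[OF S(1)] by (auto simp: bounded_iff)
  \<comment> \<open>The truncated cone \<open>w\<close> of slope \<open>L\<close> has to dominate
    \<open>\<bar>\<phi>\<bar>\<close> on \<open>S\<close>: there \<open>norm y \<le> s\<close>, so
    \<open>w y \<ge> L * (R - s) = b\<close> and the clamping is inactive. Since
    \<open>e > 0\<close>, \<open>L\<close> is positive even for \<open>M = 0\<close>.\<close>
  define R where "R = s + b / L"
  define w where "w y = L * max 0 (R - norm y)" for y :: "real^'n"
  have w_lip: "\<bar>w y - w x\<bar> \<le> L * norm (y - x)" for x y
  proof -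
    have "\<bar>max 0 (R - norm y) - max 0 (R - norm x)\<bar> \<le> norm (y - x)"
      using norm_triangle_ineq3[of y x] by linarith
    then show ?thesis
      using L unfolding w_def by (simp add: abs_mult flip: right_diff_distrib)
  qed
  have w_S: "b \<le> w y" if "y \<in> S" for y
  proof -
    have "L * (b / L) \<le> w y"
      unfolding w_def using s[OF that] L by (intro mult_left_mono) (auto simp: R_def)
    then show ?thesis using L by simp
  qed
  define g where "g y = max (- w y) (min (g0 y) (w y))" for y
  have g_lip: "\<bar>g y - g x\<bar> \<le> L * norm (y - x)" for x y
    unfolding g_def using g0_lip[of y x] w_lip[of y x] by linarith
  have "L-lipschitz_on UNIV g"
    using g_lip L by (intro lipschitz_onI) (auto simp: dist_norm)
  then have g_cont: "continuous_on UNIV g"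
    by (rule lipschitz_on_continuous_on)
  have g_0: "g x = 0" if "R < norm x" for x
    using that L by (simp add: g_def w_def max_def min_def)
  have g_S: "g y = \<phi> y" if "y \<in> S" for y
    using w_S[OF that] b[of y] closest_point_self[OF that] by (auto simp: g_def g0_def abs_le_iff)
  obtain d2 where d2: "d2 > 0" "\<And>r (\<rho> :: real^'n \<Rightarrow> real) x. r \<le> d2 \<Longrightarrow> mollifier r \<rho> \<Longrightarrow>
    \<bar>convolution \<rho> \<phi> x - \<phi> x\<bar> \<le> e \<and> norm (gradient (convolution \<rho> \<phi>) x - gradient \<phi> x) \<le> e"
    using mollification_approximates[OF \<phi> e] by blast
  \<comment> \<open>Points within \<open>\<delta> / 2\<close> of some
    \<open>x \<in> \<Omega>\<close>, shifted by less than \<open>r\<close>, stay in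
    \<open>S\<close>. So \<open>g\<close> and \<open>\<phi>\<close> have the same mollification near
    \<open>x\<close>, and \<open>r \<le> d2\<close> makes its gradient close to that of
    \<open>\<phi>\<close>.\<close>
  define r where "r = min (\<delta> / 2) d2"
  have r: "r > 0" "r \<le> \<delta> / 2" "r \<le> d2" using \<delta> d2 by (auto simp: r_def)
  obtain \<rho> :: "real^'n \<Rightarrow> real" where \<rho>: "mollifier r \<rho>" using ex_mollifier[OF r(1)] by blast
  define u where "u = convolution \<rho> g"
  have u: "u \<in> test_functions"
    unfolding u_def by (rule convolution_mollifier_test_function[OF \<rho> g_cont g_0])
  show thesis
  proof (rule that[OF u])
    show "norm (gradient u x) \<le> M + e" for x
      unfolding L_def[symmetric]
    proof (rule gradient_norm_le_lipschitz)
      show "u differentiable (at x)" using C1_compactD(1)[OF test_functions_C1_compact[OF u]] .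
      show "\<bar>u y - u x\<bar> \<le> L * norm (y - x)" for y
        unfolding u_def by (rule convolution_lipschitz[OF \<rho> g_cont g_lip])
    qed (use L in simp)
    fix x assume x: "x \<in> \<Omega>"
    have "gradient u x = gradient (convolution \<rho> \<phi>) x"
    proof (rule gradient_cong_open)
      show "open (ball x (\<delta> / 2))" "x \<in> ball x (\<delta> / 2)" using \<delta> by auto
      show "convolution \<rho> \<phi> differentiable (at x)"
        using convolution_has_derivative[OF mollifierD(1,2)[OF \<rho>] \<phi>] by (rule differentiableI)
      fix z assume z: "z \<in> ball x (\<delta> / 2)"
      have "\<rho> y *\<^sub>R \<phi> (z - y) = \<rho> y *\<^sub>R g (z - y)" for y
      proof (cases "norm y < r")
        case True
        have "norm (z - y - x) \<le> norm (z - x) + norm y"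
          using norm_triangle_ineq4[of "z - x" y] by (simp add: algebra_simps)
        also have "\<dots> \<le> \<delta>"
          using True z r(2) by (simp add: dist_norm norm_minus_commute)
        finally show ?thesis using g_S[OF in_S[OF x]] by simp
      next
        case False
        then show ?thesis using \<rho> by (simp add: mollifier_def)
      qed
      then show "convolution \<rho> \<phi> z = u z" by (simp only: u_def convolution_def)
    qed
    then show "norm (gradient u x - gradient \<phi> x) \<le> e"
      using d2(2)[OF r(3) \<rho>, of x] by simp
  qed
qed

context gradient_bounded_functional
begin

text \<open>For an approximant \<open>u\<close> the bound on \<Omega> becomes global up to
  \<open>e\<close>, and \<open>u / (M + e)\<close> competes in the supremum \<open>W\<close>.
  Passing from \<open>\<phi>\<close> to \<open>u\<close> costs at most \<open>C * e\<close>, since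
  only gradients on \<Omega> count.\<close>

lemma C1_extension_le_dual_norm:
  assumes \<Omega>: "convex \<Omega>" "compact \<Omega>" "\<Omega> \<noteq> {}" and \<phi>: "\<phi> \<in> C1_compact"
    and M: "M \<ge> 0" "\<And>x. x \<in> \<Omega> \<Longrightarrow> norm (gradient \<phi> x) \<le> M"
    and W: "\<And>u. u \<in> C1_compact \<Longrightarrow> (\<And>x. norm (gradient u x) \<le> 1) \<Longrightarrow> C1_extension f u \<le> W"
  shows "C1_extension f \<phi> \<le> W * M"
proof -
  have est: "C1_extension f \<phi> \<le> W * M + (W + C) * e" if e: "e > 0" for e
  proof -
    obtain u where u: "u \<in> test_functions" "\<And>x. norm (gradient u x) \<le> M + e"
      "\<And>x. x \<in> \<Omega> \<Longrightarrow> norm (gradient u x - gradient \<phi> x) \<le> e"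
      using global_gradient_bound_approx[OF \<Omega> \<phi> M e] by blast
    have u': "u \<in> C1_compact" by (rule test_functions_C1_compact[OF u(1)])
    define c where "c = M + e"
    have c: "c > 0" using M e by (simp add: c_def)
    let ?v = "\<lambda>x. (1 / c) * u x + 0 * u x"
    have "C1_extension f ?v \<le> W"
    proof (rule W)
      show "norm (gradient ?v x) \<le> 1" for x
        unfolding gradient_linear_combination[OF C1_compactD(1)[OF u'] C1_compactD(1)[OF u']]
        using u(2)[of x] c by (simp add: c_def)
    qed (intro C1_compact_linear_combination u')
    then have "C1_extension f u \<le> W * c"
      unfolding C1_extension_linear[OF u' u'] using c by (simp add: field_simps)
    moreover have "\<bar>f u - C1_extension f \<phi>\<bar> \<le> C * e"
      by (rule C1_extension_approx[OF \<phi> u(1,3)])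
    moreover have "\<bar>f u - C1_extension f u\<bar> \<le> C * 0"
      by (rule C1_extension_approx[OF u' u(1)]) simp
    ultimately show ?thesis by (simp add: c_def algebra_simps)
  qed
  have "0 \<le> W"
    using W[OF test_functions_C1_compact[OF zero_test_function]] by (simp add: C1_extension_0)
  then have WC: "W + C \<ge> 0" using C_nonneg by simp
  show ?thesis
  proof (rule field_le_epsilon)
    fix e :: real assume e: "e > 0"
    have "C1_extension f \<phi> \<le> W * M + (W + C) * (e / (W + C + 1))"
      using e WC by (intro est divide_pos_pos) auto
    also have "(W + C) * (e / (W + C + 1)) = e * ((W + C) / (W + C + 1))" by simp
    also have "\<dots> \<le> e * 1" using e WC by (intro mult_left_mono) auto
    finally show "C1_extension f \<phi> \<le> W * M + e" by simp
  qed
qed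

end

section \<open>A space-filling curve\<close>

text \<open>The digits are differences of dyadic floors, so the partial sums telescope to
  \<open>\<lfloor>2 ^ n * y\<rfloor> / 2 ^ n\<close>. The condition \<open>y < 1\<close> makes the
  initial floor 0.\<close>

lemma binary_expansion:
  fixes y :: real
  assumes "0 \<le> y" "y < 1"
  obtains a :: "nat \<Rightarrow> real" where "\<And>k. a k = 0 \<or> a k = 1" "(\<lambda>k. a k / 2 ^ Suc k) sums y"
proof -
  define a where "a k = real_of_int (\<lfloor>2 ^ Suc k * y\<rfloor> - 2 * \<lfloor>2 ^ k * y\<rfloor>)" for k
  have "a k = 0 \<or> a k = 1" for k
  proof -
    let ?z = "2 ^ k * y"
    have "\<lfloor>2 * ?z\<rfloor> - 2 * \<lfloor>?z\<rfloor> = 0 \<or> \<lfloor>2 * ?z\<rfloor> - 2 * \<lfloor>?z\<rfloor> = 1"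
      by linarith
    then show ?thesis
      unfolding a_def by (auto simp: mult.assoc)
  qed
  moreover
  have sum_eq: "(\<Sum>k<n. a k / 2 ^ Suc k) = \<lfloor>2 ^ n * y\<rfloor> / 2 ^ n" for n
  proof (induction n)
    case 0
    have "\<lfloor>y\<rfloor> = 0" using assms by linarith
    then show ?case by simp
  next
    case (Suc n)
    then show ?case by (simp add: a_def field_simps)
  qed
  have "(\<lambda>n. \<lfloor>2 ^ n * y\<rfloor> / 2 ^ n) \<longlonglongrightarrow> y"
  proof (rule Lim_null[THEN iffD2], rule tendsto_0_le[where K=1])
    show "(\<lambda>n. (1/2::real) ^ n) \<longlonglongrightarrow> 0"
      by (rule LIMSEQ_power_zero) simp
    show "\<forall>\<^sub>F n in sequentially. norm (\<lfloor>2 ^ n * y\<rfloor> / 2 ^ n - y) \<le> norm ((1/2::real) ^ n) * 1"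
    proof (intro always_eventually allI)
      fix n
      have "norm (\<lfloor>2 ^ n * y\<rfloor> / 2 ^ n - y) = \<bar>\<lfloor>2 ^ n * y\<rfloor> - 2 ^ n * y\<bar> / 2 ^ n"
        by (simp add: field_simps abs_divide flip: abs_mult)
      also have "\<dots> \<le> 1 / 2 ^ n"
        by (rule divide_right_mono) (linarith, simp)
      finally show "norm (\<lfloor>2 ^ n * y\<rfloor> / 2 ^ n - y) \<le> norm ((1/2::real) ^ n) * 1"
        by (simp add: power_one_over)
    qed
  qed
  then have "(\<lambda>k. a k / 2 ^ Suc k) sums y"
    unfolding sums_def sum_eq .
  ultimately show thesis using that by blast
qed

text \<open>Clipping a cosine gives at once continuity, period 2, the value 0 on
  \<open>[0, 1/3]\<close> and the value 1 on \<open>[2/3, 1]\<close>: the intervals of a first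
  ternary digit 0 or 2.\<close>

definition schoenberg :: "real \<Rightarrow> real" where
  "schoenberg t = max 0 (min 1 (1/2 - cos (pi * t)))"

lemma schoenberg_periodic: "schoenberg (2 * of_int k + t) = schoenberg t"
proof -
  have "pi * (2 * of_int k + t) = pi * t + 2 * pi * of_int k"
    by (simp add: algebra_simps)
  then have "cos (pi * (2 * of_int k + t)) = cos (pi * t)"
    by (simp only: cos_int_2pin cos_add sin_int_2pin mult_1_right mult_zero_right diff_zero)
  then show ?thesis
    by (simp add: schoenberg_def)
qed

lemma schoenberg_lower: "0 \<le> t \<Longrightarrow> t \<le> 1/3 \<Longrightarrow> schoenberg t = 0"
  using cos_monotone_0_pi_le[of "pi * t" "pi / 3"] by (simp add: schoenberg_def cos_60)

lemma schoenberg_upper: 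
  assumes "2/3 \<le> t" "t \<le> 1" 
  shows "schoenberg t = 1"
proof -
  have "cos (pi * t) \<le> cos (pi * (2/3))"
    using assms by (intro cos_monotone_0_pi_le) auto
  also have "\<dots> = - 1/2"
    using cos_120 by (simp add: field_simps)
  finally show ?thesis by (simp add: schoenberg_def)
qed

text \<open>Schoenberg's trick: the ternary digits 0 and 2 of \<open>t\<close> are read off by evaluating one
  continuous periodic function at \<open>3\<^sup>m t\<close>.\<close>

lemma schoenberg_digits:
  fixes a :: "nat \<Rightarrow> real"
  assumes a: "\<And>k. a k = 0 \<or> a k = 1"
  obtains t where "0 \<le> t" "t \<le> 1" "\<And>m. schoenberg (3 ^ m * t) = a m"
proof -
  \<comment> \<open>\<open>r m\<close> has the ternary digits \<open>2 * a m\<close>,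
    \<open>2 * a (m + 1)\<close> and so on; the required \<open>t\<close> is
    \<open>r 0\<close>.\<close>
  define r where "r m = (\<Sum>j. 2 * a (m + j) / 3 ^ Suc j)" for m
  have geo: "(\<lambda>j. 2 / 3 ^ Suc j :: real) sums 1"
    using sums_mult[OF geometric_sums[of "1/3::real"], of "2/3"]
    by (simp add: power_one_over field_simps)
  have bd: "0 \<le> a k" "a k \<le> 1" for k
    using a[of k] by auto
  have summ: "summable (\<lambda>j. 2 * a (m + j) / 3 ^ Suc j)" for m
    by (rule summable_comparison_test[OF _ sums_summable[OF geo]])
       (auto intro!: exI[of _ 0] divide_right_mono simp: bd abs_mult)
  have r01: "0 \<le> r m" "r m \<le> 1" for m
  proof -
    show "0 \<le> r m"
      unfolding r_def by (intro suminf_nonneg summ) (simp add: bd)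
    have "r m \<le> (\<Sum>j. 2 / 3 ^ Suc j)"
      unfolding r_def by (intro suminf_le summ sums_summable[OF geo]) (auto intro!: divide_right_mono simp: bd)
    then show "r m \<le> 1" using sums_unique[OF geo] by simp
  qed
  have step: "3 * r m = 2 * a m + r (Suc m)" for m
  proof -
    have "r m = (\<Sum>j. 2 * a (m + Suc j) / 3 ^ Suc (Suc j)) + 2 * a m / 3"
      using suminf_split_initial_segment[OF summ[of m], of 1] by (simp add: r_def)
    also have "(\<Sum>j. 2 * a (m + Suc j) / 3 ^ Suc (Suc j)) = r (Suc m) / 3"
      unfolding r_def suminf_divide[OF summ, symmetric] by (simp add: field_simps)
    finally show ?thesis by simp
  qed
  \<comment> \<open>Multiplication by \<open>3 ^ m\<close> shifts the digits. The integer pushed out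
    is even because all digits are, and period 2 discards it.\<close>
  have "\<exists>k::int. 3 ^ m * r 0 = 2 * of_int k + r m" for m
  proof (induction m)
    case 0
    show ?case by (intro exI[of _ 0]) simp
  next
    case (Suc m)
    then obtain k :: int where k: "3 ^ m * r 0 = 2 * of_int k + r m" by blast
    obtain c :: int where c: "a m = of_int c"
      using a[of m] by (metis of_int_0 of_int_1)
    have "3 ^ Suc m * r 0 = 2 * of_int (3 * k + c) + r (Suc m)"
      using k step[of m] c by simp
    then show ?case by blast
  qed
  then have "schoenberg (3 ^ m * r 0) = schoenberg (r m)" for m
    using schoenberg_periodic by metis
  moreover have "schoenberg (r m) = a m" for m
    using a[of m] step[of m] r01[of m] r01[of "Suc m"] schoenberg_lower[of "r m"] schoenberg_upper[of "r m"]
    by auto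
  ultimately show thesis using that[of "r 0"] r01 by simp
qed

lemma continuous_schoenberg: "continuous_on A (\<lambda>t. schoenberg (c * t))"
  unfolding schoenberg_def by (intro continuous_intros)

lemma schoenberg_bounds: "0 \<le> schoenberg t" "schoenberg t \<le> 1"
  by (auto simp: schoenberg_def)

lemma space_filling_unit_cube:
  obtains h :: "real \<Rightarrow> 'a::euclidean_space" 
  where "continuous_on UNIV h" "\<And>x. (\<And>b. b \<in> Basis \<Longrightarrow> 0 \<le> x \<bullet> b \<and> x \<bullet> b < 1) \<Longrightarrow> x \<in> h ` {0..1}"
proof -
  obtain e :: "'a \<Rightarrow> nat" where e: "inj_on e Basis"
    using finite_imp_inj_to_nat_seg finite_Basis by metis
  \<comment> \<open>One parameter \<open>t\<close> carries the binary digits of all coordinates: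
    each \<open>b\<close> gets its own disjoint set of digit positions.\<close>
  define p where "p b k = prod_encode (e b, k)" for b k
  have p_inj: "b = b' \<and> k = k'" if "p b k = p b' k'" "b \<in> Basis" "b' \<in> Basis" for b b' k k'
    using that e unfolding p_def inj_on_def by auto
  define c where "c b t = (\<Sum>k. schoenberg (3 ^ p b k * t) / 2 ^ Suc k)" for b t
  define h :: "real \<Rightarrow> 'a" where "h t = (\<Sum>b\<in>Basis. c b t *\<^sub>R b)" for t
  have geo: "summable (\<lambda>k. 1 / 2 ^ Suc k :: real)"
    using power_half_series by (auto simp: sums_iff power_one_over)
  have "continuous_on UNIV (c b)" for b
  proof (rule uniform_limit_theorem)
    show "uniform_limit UNIV (\<lambda>n t. \<Sum>k<n. schoenberg (3 ^ p b k * t) / 2 ^ Suc k) (c b) sequentially"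
      unfolding c_def
      by (rule Weierstrass_m_test[OF _ geo]) (use schoenberg_bounds in \<open>auto intro!: divide_right_mono\<close>)
    show "\<forall>\<^sub>F n in sequentially. continuous_on UNIV (\<lambda>t. \<Sum>k<n. schoenberg (3 ^ p b k * t) / 2 ^ Suc k)"
      by (intro always_eventually allI continuous_intros continuous_schoenberg) auto
  qed simp
  then have "continuous_on UNIV h"
    unfolding h_def by (intro continuous_intros)
  moreover have "x \<in> h ` {0..1}" if x: "\<And>b. b \<in> Basis \<Longrightarrow> 0 \<le> x \<bullet> b \<and> x \<bullet> b < 1" for x
  proof -
    have "\<forall>b\<in>Basis. \<exists>a :: nat \<Rightarrow> real. (\<forall>k. a k = 0 \<or> a k = 1) \<and> (\<lambda>k. a k / 2 ^ Suc k) sums (x \<bullet> b)"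
      using binary_expansion x by metis
    then obtain a :: "'a \<Rightarrow> nat \<Rightarrow> real" where a: "\<And>b k. b \<in> Basis \<Longrightarrow> a b k = 0 \<or> a b k = 1"
      "\<And>b. b \<in> Basis \<Longrightarrow> (\<lambda>k. a b k / 2 ^ Suc k) sums (x \<bullet> b)"
      by metis
    define A where "A m = (if \<exists>b\<in>Basis. \<exists>k. m = p b k \<and> a b k = 1 then 1 else 0 :: real)" for m
    have A: "A (p b k) = a b k" if "b \<in> Basis" for b k
      using a(1)[OF that] p_inj that unfolding A_def by (auto; metis)
    have "A m = 0 \<or> A m = 1" for m by (simp add: A_def)
    then obtain t where t: "0 \<le> t" "t \<le> 1" and "\<And>m. schoenberg (3 ^ m * t) = A m"
      using schoenberg_digits by metis
    then have "c b t = x \<bullet> b" if "b \<in> Basis" for b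
      using a(2)[OF that] that by (simp add: c_def A sums_iff)
    then have "h t = x"
      by (simp add: h_def euclidean_representation)
    then show ?thesis using t by auto
  qed
  ultimately show thesis using that by blast
qed

lemma space_filling_bounded:
  fixes K :: "'a::euclidean_space set"
  assumes "bounded K"
  obtains h :: "real \<Rightarrow> 'a" where "continuous_on UNIV h" "K \<subseteq> h ` {0..1}"
proof -
  obtain B where B: "B > 0" "\<And>x. x \<in> K \<Longrightarrow> norm x \<le> B"
    using assms bounded_pos by blast
  obtain g :: "real \<Rightarrow> 'a" where g: "continuous_on UNIV g"
    "\<And>x. (\<And>b. b \<in> Basis \<Longrightarrow> 0 \<le> x \<bullet> b \<and> x \<bullet> b < 1) \<Longrightarrow> x \<in> g ` {0..1}"
    using space_filling_unit_cube by blast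
  \<comment> \<open>Coordinates of points of \<open>K\<close> lie in \<open>[-B, B]\<close>;
    dividing by \<open>4 * B\<close> and centring at 1/2 puts them in \<open>[1/4, 3/4]\<close>,
    inside the half-open cube.\<close>
  define h where "h t = (4 * B) *\<^sub>R (g t - (\<Sum>b\<in>Basis. (1/2) *\<^sub>R b))" for t
  have "continuous_on UNIV h"
    unfolding h_def by (intro continuous_intros g)
  moreover have "x \<in> h ` {0..1}" if "x \<in> K" for x
  proof -
    define y where "y = (1 / (4 * B)) *\<^sub>R x + (\<Sum>b\<in>Basis. (1/2) *\<^sub>R b)"
    have "0 \<le> y \<bullet> b \<and> y \<bullet> b < 1" if b: "b \<in> Basis" for b
    proof -
      have "y \<bullet> b = (x \<bullet> b) / (4 * B) + 1/2"
        using b by (simp add: y_def inner_add_left inner_sum_left inner_Basis if_distrib cong: if_cong)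
      moreover have "\<bar>x \<bullet> b\<bar> \<le> B"
        using Basis_le_norm[OF b, of x] B(2)[OF \<open>x \<in> K\<close>] by linarith
      then have "\<bar>(x \<bullet> b) / (4 * B)\<bar> \<le> 1 / 4"
        using B(1) by (simp add: field_simps)
      ultimately show ?thesis by linarith
    qed
    then have "y \<in> g ` {0..1}" using g(2) by blast
    then obtain t where t: "t \<in> {0..1}" "g t = y" by blast
    then have "h t = x"
      using B(1) by (simp add: h_def y_def)
    then show ?thesis using t(1) by blast
  qed
  ultimately show thesis using that by blast
qed

section \<open>Measures representing dominated functionals\<close>

text \<open>A code is a finite set of pairs of basic open sets, and \<open>R i l\<close> says that
  \<open>f i\<close> maps \<open>U \<inter> K\<close> into \<open>V\<close> for each pair. There are
  countably many codes; one function is picked per realizable code. Covering \<open>K\<close> by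
  sets on which \<open>f i\<close> varies little gives a code all of whose realizations are
  uniformly close to \<open>f i\<close>.\<close>

lemma separable_continuous_family:
  fixes f :: "'i \<Rightarrow> 'a::second_countable_topology \<Rightarrow> 'b::{second_countable_topology,metric_space}"
  assumes K: "compact K" and cont: "\<And>i. i \<in> I \<Longrightarrow> continuous_on K (f i)"
  obtains D where "D \<subseteq> I" "countable D"
    "\<And>i e. i \<in> I \<Longrightarrow> e > 0 \<Longrightarrow> \<exists>j\<in>D. \<forall>x\<in>K. dist (f i x) (f j x) < e"
proof -
  obtain A :: "'a set set" where A: "countable A" "topological_basis A"
    using ex_countable_basis by blast
  obtain B :: "'b set set" where B: "countable B" "topological_basis B"
    using ex_countable_basis by blast
  define R where "R i l \<longleftrightarrow> (\<forall>(U, V)\<in>l. f i ` (U \<inter> K) \<subseteq> V)" for i l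
  define codes where "codes = {l. finite l \<and> l \<subseteq> A \<times> B}"
  define pick where "pick l = (SOME i. i \<in> I \<and> R i l)" for l
  define D where "D = pick ` {l \<in> codes. \<exists>i\<in>I. R i l}"
  have pick: "pick l \<in> I \<and> R (pick l) l" if "i \<in> I" "R i l" for i l
    unfolding pick_def using that by (intro someI[where P="\<lambda>i. i \<in> I \<and> R i l"]) auto
  have "countable codes"
    unfolding codes_def using A B by (auto intro!: countable_Collect_finite_subset)
  then have "countable D"
    unfolding D_def by (intro countable_image) (auto intro: countable_subset[rotated])
  moreover have "D \<subseteq> I"
    using pick by (auto simp: D_def)
  moreover have "\<exists>j\<in>D. \<forall>x\<in>K. dist (f i x) (f j x) < e" if i: "i \<in> I" and e: "e > 0" for i e
  proof -
    have "\<exists>U V. U \<in> A \<and> V \<in> B \<and> x \<in> U \<and> f i ` (U \<inter> K) \<subseteq> V \<and> V \<subseteq> ball (f i x) (e/2)" if x: "x \<in> K" for x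
    proof -
      obtain V where V: "V \<in> B" "f i x \<in> V" "V \<subseteq> ball (f i x) (e/2)"
        using topological_basisE[OF B(2), of "ball (f i x) (e/2)" "f i x"] e by auto
      have "open V" using V(1) B(2) topological_basis_open by blast
      then obtain T where T: "open T" "T \<inter> K = f i -` V \<inter> K"
        using cont[OF i] unfolding continuous_on_open_invariant by blast
      obtain U where "U \<in> A" "x \<in> U" "U \<subseteq> T"
        using topological_basisE[OF A(2) T(1), of x] T(2) V(2) x by blast
      then show ?thesis using V T by blast
    qed
    then obtain U V where UV: "\<And>x. x \<in> K \<Longrightarrow> U x \<in> A \<and> V x \<in> B \<and> x \<in> U x \<and> f i ` (U x \<inter> K) \<subseteq> V x
        \<and> V x \<subseteq> ball (f i x) (e/2)"
      by metis
    have "\<And>x. x \<in> K \<Longrightarrow> open (U x)"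
      using UV A(2) topological_basis_open by blast
    moreover have "K \<subseteq> (\<Union>x\<in>K. U x)"
      using UV by blast
    ultimately obtain X where X: "X \<subseteq> K" "finite X" "K \<subseteq> (\<Union>x\<in>X. U x)"
      using compactE_image[OF K] by metis
    define l where "l = (\<lambda>x. (U x, V x)) ` X"
    have l: "l \<in> codes"
      using X UV by (auto simp: l_def codes_def)
    have Rl: "R i l"
      unfolding l_def R_def using X(1) UV by (simp add: subset_iff)
    then have "pick l \<in> D" using i Rl l by (auto simp: D_def)
    moreover have "dist (f i y) (f (pick l) y) < e" if y: "y \<in> K" for y
    proof -
      obtain x where x: "x \<in> X" "y \<in> U x" using X y by blast
      have "f (pick l) y \<in> V x"
        using pick[OF i Rl] x y by (auto simp: R_def l_def)
      moreover have "f i y \<in> V x" using UV[of x] x y X by blast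
      moreover have "V x \<subseteq> ball (f i x) (e/2)" using UV[of x] x X by blast
      ultimately have "dist (f i x) (f i y) < e/2" "dist (f i x) (f (pick l) y) < e/2"
        by (auto simp: subset_iff)
      then show ?thesis
        by (metis dist_commute dist_triangle_half_r)
    qed
    ultimately show ?thesis by blast
  qed
  ultimately show thesis using that by blast
qed

text \<open>The pmf is the convex combination of \<open>p\<close> and the point mass at
  \<open>z\<close>, as needed for the descent step.\<close>

lemma expectation_bernoulli_mixture:
  fixes g :: "'a \<Rightarrow> real"
  assumes "finite (set_pmf p)" "0 \<le> s" "s \<le> 1"
  shows "measure_pmf.expectation (bind_pmf (bernoulli_pmf s) (\<lambda>b. if b then return_pmf z else p)) g
       = s * g z + (1 - s) * measure_pmf.expectation p g"
  using assms by (subst pmf_expectation_bind[where A=UNIV]) (auto simp: UNIV_bool)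

text \<open>One Frank--Wolfe step towards the minimizing point mass decreases the squared error by a
  definite amount unless the error is already small.\<close>

lemma approximate_moments_pmf:
  fixes P :: "(('a::topological_space \<Rightarrow> real) \<times> real) set"
  assumes K: "compact K" "K \<noteq> {}"
    and cont: "\<And>g l. (g, l) \<in> P \<Longrightarrow> continuous_on K g"
    and zero: "(\<lambda>_. 0, 0) \<in> P"
    and lin: "\<And>a g l h m. (g, l) \<in> P \<Longrightarrow> (h, m) \<in> P \<Longrightarrow> (\<lambda>x. a * g x + h x, a * l + m) \<in> P"
    and dom: "\<And>g l B. (g, l) \<in> P \<Longrightarrow> (\<And>x. x \<in> K \<Longrightarrow> g x \<le> B) \<Longrightarrow> l \<le> W * B"
    and J: "finite J" "J \<subseteq> P" and e: "e > 0"
  shows "\<exists>p. set_pmf p \<subseteq> K \<and> (\<forall>(g, l)\<in>J. \<bar>W * measure_pmf.expectation p g - l\<bar> < e)"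
proof -
  define S where "S = {p. finite (set_pmf p) \<and> set_pmf p \<subseteq> K}"
  define err where "err p j = W * measure_pmf.expectation p (fst j) - snd j" for p and j :: "('a \<Rightarrow> real) \<times> real"
  define Q where "Q p = (\<Sum>j\<in>J. (err p j)\<^sup>2)" for p
  define q where "q = Inf (Q ` S)"
  have contJ: "continuous_on K (fst j)" if "j \<in> J" for j
    using that J cont[of "fst j" "snd j"] by auto
  have "\<exists>b. \<forall>x\<in>K. \<bar>fst j x\<bar> \<le> b" if "j \<in> J" for j
  proof -
    have "bounded (fst j ` K)"
      by (intro compact_imp_bounded compact_continuous_image K contJ that)
    then show ?thesis
      by (simp add: bounded_iff)
  qed
  then obtain b where b: "\<And>j x. j \<in> J \<Longrightarrow> x \<in> K \<Longrightarrow> \<bar>fst j x\<bar> \<le> b j"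
    by metis
  define R where "R = (\<Sum>j\<in>J. (2 * \<bar>W\<bar> * b j)\<^sup>2)"
  have R: "R \<ge> 0" unfolding R_def by (simp add: sum_nonneg)
  obtain z0 where "z0 \<in> K" using K by blast
  then have S_ne: "return_pmf z0 \<in> S" by (simp add: S_def)
  have Q_nonneg: "Q p \<ge> 0" for p by (simp add: Q_def sum_nonneg)
  have combination: "(\<lambda>x. \<Sum>j\<in>J'. c j * fst j x, \<Sum>j\<in>J'. c j * snd j) \<in> P" if "J' \<subseteq> J" for J' c
    using finite_subset[OF that J(1)] that
  proof (induction J')
    case empty
    then show ?case using zero by simp
  next
    case (insert j J')
    then have "(fst j, snd j) \<in> P" using J by auto
    from lin[OF this, of "\<lambda>x. \<Sum>j\<in>J'. c j * fst j x" "\<Sum>j\<in>J'. c j * snd j" "c j"]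
    show ?case using insert by simp
  qed
  \<comment> \<open>The infimum \<open>q\<close> need not be attained, so the descent is stated for
    arbitrary \<open>p\<close> and compared with \<open>q\<close>.\<close>
  have step: "q \<le> (1 - 2 * s) * Q p + s\<^sup>2 * R" if p: "p \<in> S" and s: "0 \<le> s" "s \<le> 1" for p s
  proof -
    \<comment> \<open>Up to the factor \<open>2 * W\<close> this is the derivative of
      \<open>Q\<close> at \<open>p\<close> in the direction of a point mass at \<open>x\<close>; the
      step goes to a minimum point \<open>z\<close>.\<close>
    define \<psi> where "\<psi> x = (\<Sum>j\<in>J. err p j * fst j x)" for x
    have "continuous_on K \<psi>"
      using contJ unfolding \<psi>_def by (intro continuous_intros)
    then obtain z where z: "z \<in> K" "\<And>x. x \<in> K \<Longrightarrow> \<psi> z \<le> \<psi> x"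
      using continuous_attains_inf[OF K] by blast
    \<comment> \<open>Domination enters here, for the combination with coefficients
      \<open>- err p j\<close>, whose maximum over \<open>K\<close> is \<open>- \<psi> z\<close>. It
      makes the first-order change of \<open>Q\<close> at most \<open>- 2 * s * Q p\<close>.\<close>
    have "- (\<Sum>j\<in>J. err p j * snd j) \<le> W * (- \<psi> z)"
      by (rule dom[OF combination[OF order_refl, of "\<lambda>j. - err p j", unfolded mult_minus_left sum_negf]])
         (use z in \<open>auto simp: \<psi>_def\<close>)
    then have Wz: "W * \<psi> z \<le> (\<Sum>j\<in>J. err p j * snd j)" by simp
    define d where "d j = W * (fst j z - measure_pmf.expectation p (fst j))" for j :: "('a \<Rightarrow> real) \<times> real"
    have "err p j * d j = W * (err p j * fst j z) - err p j * (err p j + snd j)" for j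
      by (simp add: d_def err_def algebra_simps)
    then have "(\<Sum>j\<in>J. err p j * d j) = W * \<psi> z - (\<Sum>j\<in>J. err p j * (err p j + snd j))"
      by (simp add: \<psi>_def sum_distrib_left sum_subtractf)
    also have "\<dots> \<le> - Q p"
      using Wz by (simp add: Q_def algebra_simps sum.distrib power2_eq_square)
    finally have cross: "(\<Sum>j\<in>J. err p j * d j) \<le> - Q p" .
    have "\<bar>d j\<bar> \<le> 2 * \<bar>W\<bar> * b j" if j: "j \<in> J" for j
    proof -
      have "\<bar>measure_pmf.expectation p (fst j)\<bar> \<le> measure_pmf.expectation p (\<lambda>_. b j)"
        using p b[OF j] unfolding S_def
        by (intro order_trans[OF integral_abs_bound] integral_mono_AE)
           (auto simp: AE_measure_pmf_iff integrable_measure_pmf_finite)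
      then have "\<bar>fst j z - measure_pmf.expectation p (fst j)\<bar> \<le> 2 * b j"
        using b[OF j z(1)] by simp
      then show ?thesis
        using mult_left_mono[of _ _ "\<bar>W\<bar>"] by (fastforce simp: d_def abs_mult)
    qed
    then have dR: "(\<Sum>j\<in>J. (d j)\<^sup>2) \<le> R"
      unfolding R_def by (intro sum_mono) (metis abs_ge_zero power2_abs power_mono)
    define p' where "p' = bind_pmf (bernoulli_pmf s) (\<lambda>b. if b then return_pmf z else p)"
    have "set_pmf p' \<subseteq> insert z (set_pmf p)"
      by (auto simp: p'_def split: if_splits)
    then have "p' \<in> S"
      using p z(1) finite_subset by (auto simp: S_def)
    have err': "err p' j = err p j + s * d j" for j
      using p s unfolding err_def p'_def d_def S_def
      by (subst expectation_bernoulli_mixture) (auto simp: algebra_simps)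
    have "q \<le> Q p'"
      unfolding q_def using \<open>p' \<in> S\<close> Q_nonneg by (intro cInf_lower) (auto intro!: bdd_belowI[of _ 0])
    also have "Q p' = Q p + 2 * s * (\<Sum>j\<in>J. err p j * d j) + s\<^sup>2 * (\<Sum>j\<in>J. (d j)\<^sup>2)"
      by (simp add: Q_def err' power2_eq_square algebra_simps sum.distrib sum_distrib_left)
    also have "\<dots> \<le> Q p + 2 * s * (- Q p) + s\<^sup>2 * R"
      using cross dR s by (intro add_mono mult_left_mono) auto
    finally show ?thesis by (simp add: algebra_simps)
  qed
  have "q \<le> 0"
  proof (rule ccontr)
    assume "\<not> q \<le> 0"
    then have q: "q > 0" by simp
    \<comment> \<open>Passing to the infimum over \<open>p\<close> in \<open>step\<close> yields
      \<open>2 * q \<le> s * R\<close>, which \<open>s \<le> q / (R + 1)\<close> contradicts;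
      \<open>s \<le> 1/4\<close> keeps \<open>1 - 2 * s\<close> positive.\<close>
    define s where "s = min (1/4) (q / (R + 1))"
    have "0 < q / (R + 1)" using q R by simp
    then have "0 < s" unfolding s_def by simp
    moreover have "s \<le> 1/4" "s \<le> q / (R + 1)"
      unfolding s_def by (rule min.cobounded1, rule min.cobounded2)
    ultimately have s: "0 < s" "s \<le> 1/4" "s \<le> q / (R + 1)" .
    have "(q - s\<^sup>2 * R) / (1 - 2 * s) \<le> q"
      unfolding q_def
      by (rule cInf_greatest) (use S_ne step s in \<open>auto simp: field_simps q_def[symmetric]\<close>)
    then have "q - s\<^sup>2 * R \<le> q - 2 * s * q"
      using s by (simp add: field_simps)
    then have "s * (2 * q) \<le> s * (s * R)" by (simp add: power2_eq_square algebra_simps)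
    then have "2 * q \<le> s * R" using s by simp
    also have "\<dots> \<le> (q / (R + 1)) * R" using s R by (intro mult_right_mono) auto
    also have "\<dots> \<le> q" using q R by (simp add: field_simps)
    finally show False using q by simp
  qed
  then have "Inf (Q ` S) < e\<^sup>2" using e unfolding q_def by (smt (verit) zero_less_power)
  then obtain p where p: "p \<in> S" "Q p < e\<^sup>2"
    using S_ne by (subst (asm) cInf_less_iff) (auto intro!: bdd_belowI[of _ 0] Q_nonneg)
  have "\<bar>err p j\<bar> < e" if "j \<in> J" for j
  proof -
    have "(err p j)\<^sup>2 \<le> Q p"
      unfolding Q_def using J that by (intro member_le_sum) auto
    then have "\<bar>err p j\<bar>\<^sup>2 < e\<^sup>2" using p(2) by simp
    then show ?thesis by (rule power2_less_imp_less) (use e in simp)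
  qed
  then show ?thesis
    using p(1) by (auto simp: S_def err_def)
qed

lemma compact_pmf_weak_limit:
  fixes K :: "'a::euclidean_space set" and p :: "nat \<Rightarrow> 'a pmf"
  assumes K: "compact K" and p: "\<And>n. set_pmf (p n) \<subseteq> K"
  shows "\<exists>M r. prob_space M \<and> sets M = sets (restrict_space borel K) \<and> strict_mono (r :: nat \<Rightarrow> nat) \<and>
    (\<forall>g :: 'a \<Rightarrow> real. continuous_on K g \<longrightarrow>
       (\<lambda>n. measure_pmf.expectation (p (r n)) g) \<longlonglongrightarrow> integral\<^sup>L M g)"
proof -
  obtain h :: "real \<Rightarrow> 'a" where h: "continuous_on UNIV h" "K \<subseteq> h ` {0..1}"
    using space_filling_bounded compact_imp_bounded[OF K] by blast
  have h_borel [measurable]: "h \<in> borel_measurable borel"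
    using h(1) by (rule borel_measurable_continuous_onI)
  have "\<forall>z\<in>K. \<exists>t\<in>{0..1}. h t = z" using h(2) by blast
  \<comment> \<open>An arbitrary choice of preimages suffices, since every function is measurable
    with respect to a pmf.\<close>
  then obtain c where c: "\<And>z. z \<in> K \<Longrightarrow> c z \<in> {0..1} \<and> h (c z) = z" by metis
  define \<mu> where "\<mu> n = distr (measure_pmf (p n)) borel c" for n
  have \<mu>_dist: "real_distribution (\<mu> n)" for n
    unfolding \<mu>_def by (rule prob_space.real_distribution_distr) (auto intro: prob_space_measure_pmf)
  \<comment> \<open>Tightness is phrased with half-open intervals, so the left end lies below 0 to
    include possible mass at 0.\<close>
  have "measure (\<mu> n) {-1<..1} = 1" for n
  proof -
    have "measure (\<mu> n) {-1<..1} = measure (measure_pmf (p n)) (c -` {-1<..1})"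
      unfolding \<mu>_def by (subst measure_distr) auto
    also have "\<dots> = 1"
      using c p[of n] by (intro measure_pmf.prob_eq_1[THEN iffD2]) (force simp: AE_measure_pmf_iff)+
    finally show ?thesis .
  qed
  then have "tight \<mu>"
    unfolding tight_def using \<mu>_dist by (intro conjI allI impI exI[of _ "-1"] exI[of _ 1]) auto
  then obtain r M where r: "strict_mono r" and M: "real_distribution M" and "weak_conv_m (\<mu> \<circ> id \<circ> r) M"
    using tight_imp_convergent_subsubsequence[of \<mu> id] strict_mono_id by blast
  then have weak: "weak_conv_m (\<lambda>n. \<mu> (r n)) M" by (simp add: o_def)
  interpret M: real_distribution M by fact
  have lim: "(\<lambda>n. measure_pmf.expectation (p (r n)) g) \<longlonglongrightarrow> (\<integral>t. g (h t) \<partial>M)"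
    if g: "continuous_on UNIV g" "\<And>x. \<bar>g x\<bar> \<le> B" for g :: "'a \<Rightarrow> real" and B
  proof -
    have gh: "continuous_on UNIV (\<lambda>t. g (h t))"
      by (rule continuous_on_compose2[OF g(1) h(1)]) simp
    have "(\<lambda>n. \<integral>t. g (h t) \<partial>\<mu> (r n)) \<longlonglongrightarrow> (\<integral>t. g (h t) \<partial>M)"
      by (rule weak_conv_imp_integral_bdd_continuous_conv[OF \<mu>_dist M weak, of _ B])
         (use gh g(2) in \<open>auto simp: continuous_on_eq_continuous_within\<close>)
    moreover have "(\<integral>t. g (h t) \<partial>\<mu> n) = measure_pmf.expectation (p n) g" for n
    proof -
      have "(\<integral>t. g (h t) \<partial>\<mu> n) = measure_pmf.expectation (p n) (\<lambda>z. g (h (c z)))"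
        unfolding \<mu>_def using borel_measurable_continuous_onI[OF gh] by (subst integral_distr) auto
      also have "\<dots> = measure_pmf.expectation (p n) g"
        using p[of n] c by (intro integral_cong_AE) (auto simp: AE_measure_pmf_iff subset_iff)
      finally show ?thesis .
    qed
    ultimately show ?thesis by simp
  qed
  have "K \<noteq> {}" using p[of 0] set_pmf_not_empty by fastforce
  have hK: "AE t in M. h t \<in> K"
  proof -
    \<comment> \<open>The curve may leave \<open>K\<close>, so the limit might charge points outside
      it. This bounded continuous function vanishes exactly on \<open>K\<close>; its integral is 0
      for each pmf, hence in the limit.\<close>
    define u where "u x = min 1 (infdist x K)" for x
    have u: "continuous_on UNIV u" "\<And>x. \<bar>u x\<bar> \<le> 1"
      unfolding u_def by (auto intro!: continuous_intros simp: infdist_nonneg)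
    have "measure_pmf.expectation (p n) u = 0" for n
      using p[of n] by (intro integral_eq_zero_AE) (auto simp: AE_measure_pmf_iff u_def)
    then have "(\<integral>t. u (h t) \<partial>M) = 0"
      using lim[OF u] by (simp add: LIMSEQ_const_iff)
    moreover have "integrable M (\<lambda>t. u (h t))"
    proof (rule M.integrable_const_bound[of _ 1])
      have [measurable]: "u \<in> borel_measurable borel"
        using u(1) by (rule borel_measurable_continuous_onI)
      show "(\<lambda>t. u (h t)) \<in> borel_measurable M"
        by measurable
    qed (use u in auto)
    ultimately have "AE t in M. u (h t) = 0"
      by (subst (asm) integral_nonneg_eq_0_iff_AE) (auto simp: u_def infdist_nonneg)
    then show ?thesis
      by eventually_elim (use in_closed_iff_infdist_zero[OF compact_imp_closed[OF K] \<open>K \<noteq> {}\<close>] in \<open>auto simp: u_def min_def split: if_splits\<close>)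
  qed
  have K_borel [measurable]: "K \<in> sets borel"
    using compact_imp_closed[OF K] by simp
  define M0 where "M0 = distr M borel h"
  interpret M0: prob_space M0
    unfolding M0_def by (rule M.prob_space_distr) simp
  have AE0: "AE x in M0. x \<in> K"
    unfolding M0_def using hK by (subst AE_distr_iff) auto
  show ?thesis
  proof (intro exI conjI allI impI)
    have [simp]: "space M0 = UNIV" by (simp add: M0_def)
    have K0 [measurable]: "K \<in> sets M0" by (simp add: M0_def)
    show "prob_space (restrict_space M0 K)"
      using AE0 M0.prob_space_axioms by (intro prob_spaceI) 
        (auto simp: emeasure_restrict_space space_restrict_space M0.emeasure_eq_1_AE)
    show "sets (restrict_space M0 K) = sets (restrict_space borel K)"
      by (intro sets_restrict_space_cong) (simp add: M0_def)
    show "strict_mono r" by fact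
    fix g :: "'a \<Rightarrow> real" assume g: "continuous_on K g"
    then have "bounded (g ` K)"
      using K compact_continuous_image compact_imp_bounded by blast
    then obtain B where B: "B > 0" "\<And>x. x \<in> K \<Longrightarrow> norm (g x) \<le> B"
      by (auto simp: bounded_pos)
    \<comment> \<open>The limit relation \<open>lim\<close> concerns bounded continuous functions on
      the whole space, hence a Tietze extension with the same bound.\<close>
    obtain G where G: "continuous_on UNIV G" "\<And>x. x \<in> K \<Longrightarrow> G x = g x" "\<And>x. norm (G x) \<le> B"
      using Tietze[OF g, of UNIV B] compact_imp_closed[OF K] B by auto
    have G_borel [measurable]: "G \<in> borel_measurable borel"
      using G(1) by (rule borel_measurable_continuous_onI)
    have "measure_pmf.expectation (p n) g = measure_pmf.expectation (p n) G" for n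
      using p[of n] G(2) by (intro integral_cong_AE) (auto simp: AE_measure_pmf_iff subset_iff)
    moreover have "integral\<^sup>L (restrict_space M0 K) g = (\<integral>t. G (h t) \<partial>M)"
    proof -
      have "integral\<^sup>L (restrict_space M0 K) g = (\<integral>x. indicator K x *\<^sub>R g x \<partial>M0)"
        by (rule integral_restrict_space) simp
      also have "\<dots> = (\<integral>x. indicator K x *\<^sub>R G x \<partial>M0)"
        by (intro Bochner_Integration.integral_cong) (auto simp: G(2) indicator_def)
      also have "\<dots> = (\<integral>x. G x \<partial>M0)"
        using AE0 by (intro integral_cong_AE) (auto simp: M0_def)
      also have "\<dots> = (\<integral>t. G (h t) \<partial>M)"
        unfolding M0_def by (subst integral_distr) auto
      finally show ?thesis .
    qed
    ultimately show "(\<lambda>n. measure_pmf.expectation (p (r n)) g) \<longlonglongrightarrow> integral\<^sup>L (restrict_space M0 K) g"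
      using lim[OF G(1), of B] G(3) by simp
  qed
qed

text \<open>A form of Hahn--Banach and Riesz: the linear relation \<open>P\<close> stands for a functional
  \<open>g \<mapsto> l\<close> on a space of continuous functions.\<close>

theorem dominated_functional_measure:
  fixes K :: "'a::euclidean_space set" and P :: "(('a \<Rightarrow> real) \<times> real) set"
  assumes K: "compact K" "K \<noteq> {}"
    and cont: "\<And>g l. (g, l) \<in> P \<Longrightarrow> continuous_on K g"
    and zero: "(\<lambda>_. 0, 0) \<in> P"
    and lin: "\<And>a g l h m. (g, l) \<in> P \<Longrightarrow> (h, m) \<in> P \<Longrightarrow> (\<lambda>x. a * g x + h x, a * l + m) \<in> P"
    and dom: "\<And>g l B. (g, l) \<in> P \<Longrightarrow> (\<And>x. x \<in> K \<Longrightarrow> g x \<le> B) \<Longrightarrow> l \<le> W * B"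
  obtains M where "prob_space M" "sets M = sets (restrict_space borel K)"
    "\<And>g l. (g, l) \<in> P \<Longrightarrow> W * integral\<^sup>L M g = l"
proof -
  \<comment> \<open>Uniform density on \<open>K\<close> reduces the relation to countably many
    moments, which one sequence of probabilities can match in the limit.\<close>
  obtain D where D: "D \<subseteq> P" "countable D"
    "\<And>i e. i \<in> P \<Longrightarrow> e > 0 \<Longrightarrow> \<exists>j\<in>D. \<forall>x\<in>K. dist (fst i x) (fst j x) < e"
    by (rule separable_continuous_family[OF K(1), of P fst]) (use cont in auto)
  have "D \<noteq> {}" using D(3)[OF zero, of 1] by auto
  define d where "d = from_nat_into D"
  have d: "range d = D" "\<And>k. d k \<in> P"
    using range_from_nat_into[OF \<open>D \<noteq> {}\<close> D(2)] D(1) by (auto simp: d_def)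
  have "\<exists>p. set_pmf p \<subseteq> K \<and> (\<forall>(g, l)\<in>d ` {..n}. \<bar>W * measure_pmf.expectation p g - l\<bar> < 1 / Suc n)" for n
    by (rule approximate_moments_pmf[OF K cont zero lin dom]) (use d in auto)
  then have "\<exists>p. set_pmf p \<subseteq> K \<and>
      (\<forall>k\<in>{..n}. \<bar>W * measure_pmf.expectation p (fst (d k)) - snd (d k)\<bar> < 1 / Suc n)" for n
    by (simp add: case_prod_beta)
  then have "\<exists>p. \<forall>n. set_pmf (p n) \<subseteq> K \<and>
      (\<forall>k\<in>{..n}. \<bar>W * measure_pmf.expectation (p n) (fst (d k)) - snd (d k)\<bar> < 1 / Suc n)"
    by (intro choice allI)
  then obtain p where p': "\<forall>n. set_pmf (p n) \<subseteq> K \<and>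
      (\<forall>k\<in>{..n}. \<bar>W * measure_pmf.expectation (p n) (fst (d k)) - snd (d k)\<bar> < 1 / Suc n)"
    by (rule exE)
  have pK: "\<And>n. set_pmf (p n) \<subseteq> K"
    using p' by simp
  have p: "\<bar>W * measure_pmf.expectation (p n) (fst (d k)) - snd (d k)\<bar> < 1 / Suc n" if "k \<le> n" for n k
    using p' that by simp
  obtain M r where M: "prob_space M" "sets M = sets (restrict_space borel K)" and r: "strict_mono r"
    and lim': "\<forall>g :: 'a \<Rightarrow> real. continuous_on K g \<longrightarrow>
       (\<lambda>n. measure_pmf.expectation (p (r n)) g) \<longlonglongrightarrow> integral\<^sup>L M g"
    using compact_pmf_weak_limit[of K p, OF K(1) pK] by (elim exE conjE) (rule that)
  note lim = lim'[rule_format]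
  interpret M: prob_space M by fact
  have space_M: "space M = K"
    using sets_eq_imp_space_eq[OF M(2)] by (simp add: space_restrict_space)
  have integ: "integrable M g" if g: "continuous_on K g" for g :: "'a \<Rightarrow> real"
  proof -
    have "bounded (g ` K)"
      using K g compact_continuous_image compact_imp_bounded by blast
    then obtain B where B: "\<And>x. x \<in> K \<Longrightarrow> norm (g x) \<le> B"
      by (auto simp: bounded_iff)
    have "g \<in> borel_measurable M"
      using borel_measurable_continuous_on_restrict[OF g] measurable_cong_sets[OF M(2) refl] by blast
    then show ?thesis
      using B space_M by (intro M.integrable_const_bound[of _ B]) auto
  qed
  have base: "W * integral\<^sup>L M (fst (d k)) = snd (d k)" for k
  proof (rule LIMSEQ_unique)
    have "continuous_on K (fst (d k))" using cont[of "fst (d k)" "snd (d k)"] d(2)[of k] by simp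
    then show "(\<lambda>n. W * measure_pmf.expectation (p (r n)) (fst (d k))) \<longlonglongrightarrow> W * integral\<^sup>L M (fst (d k))"
      by (intro tendsto_intros lim)
    have "(\<lambda>n. W * measure_pmf.expectation (p n) (fst (d k))) \<longlonglongrightarrow> snd (d k)"
    proof (rule Lim_null[THEN iffD2], rule tendsto_0_le[where K=1])
      show "(\<lambda>n. 1 / real (Suc n)) \<longlonglongrightarrow> 0" by (rule LIMSEQ_Suc[OF lim_1_over_n])
      show "\<forall>\<^sub>F n in sequentially. norm (W * measure_pmf.expectation (p n) (fst (d k)) - snd (d k)) \<le> norm (1 / real (Suc n)) * 1"
        using eventually_ge_at_top[of k] by eventually_elim (use p[of k] in \<open>simp add: less_imp_le\<close>)
    qed
    then show "(\<lambda>n. W * measure_pmf.expectation (p (r n)) (fst (d k))) \<longlonglongrightarrow> snd (d k)"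
      using LIMSEQ_subseq_LIMSEQ[OF _ r] unfolding o_def by blast
  qed
  show thesis
  proof (rule that[OF M])
    fix g l assume gl: "(g, l) \<in> P"
    \<comment> \<open>Domination applied to \<open>g - ?h\<close> and \<open>?h - g\<close> bounds
      \<open>\<bar>?m - l\<bar>\<close>, and uniform closeness bounds the difference of integrals;
      each contributes \<open>\<bar>W\<bar> * e\<close>.\<close>
    have "\<bar>W * integral\<^sup>L M g - l\<bar> \<le> 0 + 2 * \<bar>W\<bar> * e" if e: "e > 0" for e
    proof -
      obtain j where j: "j \<in> D" "\<forall>x\<in>K. dist (g x) (fst j x) < e"
        using D(3)[OF gl e] by auto
      then obtain k where "j = d k" using d(1) by blast
      then have k: "\<bar>g x - fst (d k) x\<bar> < e" if "x \<in> K" for x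
        using j(2) that by (simp add: dist_real_def)
      let ?h = "fst (d k)" and ?m = "snd (d k)"
      have hm: "(?h, ?m) \<in> P" using d(2)[of k] by simp
      have "-1 * ?m + l \<le> W * e"
        by (rule dom[OF lin[OF hm gl, of "-1"]]) (use k in fastforce)
      moreover have "-1 * l + ?m \<le> W * e"
        by (rule dom[OF lin[OF gl hm, of "-1"]]) (use k in fastforce)
      moreover have "W * e \<le> \<bar>W\<bar> * e" using e by (intro mult_right_mono) auto
      ultimately have 1: "\<bar>?m - l\<bar> \<le> \<bar>W\<bar> * e" by linarith
      have "\<bar>integral\<^sup>L M g - integral\<^sup>L M ?h\<bar> = \<bar>\<integral>x. g x - ?h x \<partial>M\<bar>"
        using integ[OF cont[OF gl]] integ[OF cont[OF hm]] by (subst Bochner_Integration.integral_diff) auto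
      also have "\<dots> \<le> (\<integral>x. \<bar>g x - ?h x\<bar> \<partial>M)" by (rule integral_abs_bound)
      also have "\<dots> \<le> (\<integral>x. e \<partial>M)"
        using integ[OF cont[OF gl]] integ[OF cont[OF hm]] k space_M
        by (intro integral_mono) (auto intro!: less_imp_le)
      finally have "\<bar>W * integral\<^sup>L M g - W * integral\<^sup>L M ?h\<bar> \<le> \<bar>W\<bar> * e"
        by (simp add: M.prob_space abs_mult mult_left_mono flip: right_diff_distrib)
      then show ?thesis using 1 base[of k] by linarith
    qed
    note est = this
    have "\<bar>W * integral\<^sup>L M g - l\<bar> \<le> 0 + \<delta>" if "\<delta> > 0" for \<delta>
    proof -
      have "2 * \<bar>W\<bar> * (\<delta> / (2 * \<bar>W\<bar> + 1)) \<le> \<delta>"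
        using that by (simp add: field_simps)
      moreover have "\<delta> / (2 * \<bar>W\<bar> + 1) > 0" using that by (simp add: add_nonneg_pos)
      ultimately show ?thesis using est by fastforce
    qed
    then show "W * integral\<^sup>L M g = l"
      using field_le_epsilon[of "\<bar>W * integral\<^sup>L M g - l\<bar>" 0] by auto
  qed
qed

section \<open>The minimal measure\<close>

lemma diff_quot_le_1:
  assumes u: "u \<in> C1_compact" "\<And>x. norm (gradient u x) \<le> 1" and "norm v = 1" "t \<ge> 0"
  shows "diff_quot u (x, v, t) \<le> 1"
proof (cases "t = 0")
  case True
  have "gradient u x \<bullet> v \<le> norm (gradient u x) * norm v" by (rule norm_cauchy_schwarz)
  then show ?thesis
    using True u(2)[of x] \<open>norm v = 1\<close>
    by (simp add: diff_quot_def frechet_derivative_eq_gradient[OF C1_compactD(1)[OF u(1)]])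
next
  case False
  have "\<bar>u (x + t *\<^sub>R v) - u x\<bar> \<le> 1 * norm (x + t *\<^sub>R v - x)"
    by (rule convex_gradient_lipschitz[of UNIV]) (use u C1_compactD(1)[OF u(1)] in auto)
  then show ?thesis using False assms(3,4) by (simp add: diff_quot_def field_simps)
qed

lemma W1_le_total_variation:
  fixes \<Omega> :: "(real^'n) set"
  assumes \<tau>: "\<tau> \<in> representing_measures \<Omega> f"
  shows "W1 f \<le> ereal (total_variation \<tau>)"
  unfolding W1_def
proof (rule SUP_least)
  fix u :: "real^'n \<Rightarrow> real" assume "u \<in> {u \<in> C1_compact. \<forall>x. norm (gradient u x) \<le> 1}"
  then have u: "u \<in> C1_compact" "\<And>x. norm (gradient u x) \<le> 1" by auto
  interpret finite_measure \<tau>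
    using \<tau> by (simp add: representing_measures_def pos_finite_measures_def)
  have "sets \<tau> = sets (restrict_space borel (\<Omega> \<times> sphere 0 1 \<times> {0..}))"
    using \<tau> by (simp add: representing_measures_def pos_finite_measures_def)
  then have sp: "space \<tau> = \<Omega> \<times> sphere 0 1 \<times> {0..}"
    using sets_eq_imp_space_eq[of \<tau> "restrict_space borel (\<Omega> \<times> sphere 0 1 \<times> {0..})"]
    by (simp add: space_restrict_space)
  have "(\<integral>z. diff_quot u z \<partial>\<tau>) \<le> measure \<tau> (space \<tau>)"
  proof (cases "integrable \<tau> (diff_quot u)")
    case True
    then have "(\<integral>z. diff_quot u z \<partial>\<tau>) \<le> (\<integral>z. 1 \<partial>\<tau>)"
      using diff_quot_le_1[OF u] by (intro integral_mono) (auto simp: sp)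
    then show ?thesis by simp
  \<comment> \<open>Without integrability the integral has the default value 0, which is also at
    most the total mass.\<close>
  qed (simp add: not_integrable_integral_eq)
  then show "ereal (C1_extension f u) \<le> ereal (total_variation \<tau>)"
    using \<tau> u(1) by (simp add: representing_measures_def total_variation_def)
qed

lemma diff_quot_measurable:
  fixes \<phi> :: "real^'n \<Rightarrow> real"
  assumes \<phi>: "\<phi> \<in> C1_compact"
  shows "diff_quot \<phi> \<in> borel_measurable borel"
proof -
  have "diff_quot \<phi> = (\<lambda>z. if snd (snd z) \<noteq> 0
      then (\<phi> (fst z + snd (snd z) *\<^sub>R fst (snd z)) - \<phi> (fst z)) / snd (snd z)
      else gradient \<phi> (fst z) \<bullet> fst (snd z))"
    by (auto simp: diff_quot_def frechet_derivative_eq_gradient[OF C1_compactD(1)[OF \<phi>]])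
  moreover have "(\<lambda>z. snd (snd z) :: real) \<in> borel_measurable (borel :: ((real^'n) \<times> (real^'n) \<times> real) measure)"
    by (intro borel_measurable_continuous_onI continuous_intros)
  moreover have "(\<lambda>z. \<phi> (fst z + snd (snd z) *\<^sub>R fst (snd z)) - \<phi> (fst z)) \<in> borel_measurable (borel :: ((real^'n) \<times> (real^'n) \<times> real) measure)"
    by (intro borel_measurable_continuous_onI continuous_intros continuous_on_compose2[OF C1_compactD(3)[OF \<phi>]]) auto
  moreover have "(\<lambda>z. gradient \<phi> (fst z) \<bullet> fst (snd z)) \<in> borel_measurable (borel :: ((real^'n) \<times> (real^'n) \<times> real) measure)"
    by (intro borel_measurable_continuous_onI continuous_intros continuous_on_compose2[OF C1_compactD(4)[OF \<phi>]]) auto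
  ultimately show ?thesis by simp
qed

text \<open>The direction \<open>sgn g\<close> gives the norm. For \<open>g = 0\<close> a unit
  vector is still needed to see that \<open>B\<close> is nonnegative.\<close>

lemma norm_le_of_inner_sphere:
  fixes g :: "'a::euclidean_space"
  assumes "\<And>v. norm v = 1 \<Longrightarrow> g \<bullet> v \<le> B"
  shows "norm g \<le> B"
proof (cases "g = 0")
  case True
  then show ?thesis using assms[of "SOME b. b \<in> Basis"] by (simp add: SOME_Basis)
next
  case False
  then have "g \<bullet> sgn g \<le> B" by (intro assms) (simp add: norm_sgn)
  moreover have "g \<bullet> sgn g = norm g"
    using False by (simp add: sgn_div_norm dot_square_norm power2_eq_square field_simps)
  ultimately show ?thesis by simp
qed

section \<open>Finiteness of \<open>W1\<close> and a measure attaining it\<close>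

context gradient_bounded_functional
begin

lemma W1_finite:
  obtains W where "W1 f = ereal W" "W \<ge> 0"
    "\<And>u. u \<in> C1_compact \<Longrightarrow> (\<And>x. norm (gradient u x) \<le> 1) \<Longrightarrow> C1_extension f u \<le> W"
proof -
  have "ereal (C1_extension f (\<lambda>_. 0)) \<le> W1 f"
    unfolding W1_def using test_functions_C1_compact[OF zero_test_function] by (intro SUP_upper) auto
  then have "0 \<le> W1 f" by (simp add: C1_extension_0 flip: zero_ereal_def)
  moreover have "W1 f \<le> ereal C"
    unfolding W1_def
  proof (rule SUP_least)
    fix u :: "real^'n \<Rightarrow> real" assume "u \<in> {u \<in> C1_compact. \<forall>x. norm (gradient u x) \<le> 1}"
    then have "\<bar>C1_extension f u\<bar> \<le> C * 1" by (intro C1_extension_bound) auto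
    then show "ereal (C1_extension f u) \<le> ereal C" by simp
  qed
  ultimately obtain W where W: "W1 f = ereal W" by (cases "W1 f") auto
  show thesis
  proof (rule that[OF W])
    show "W \<ge> 0" using \<open>0 \<le> W1 f\<close> W by simp
    fix u :: "real^'n \<Rightarrow> real" assume "u \<in> C1_compact" "\<And>x. norm (gradient u x) \<le> 1"
    then have "ereal (C1_extension f u) \<le> W1 f"
      unfolding W1_def by (intro SUP_upper) auto
    then show "C1_extension f u \<le> W" by (simp add: W)
  qed
qed

text \<open>\<open>M\<close> is a probability, so \<open>W\<close> times its image has mass exactly
  \<open>W\<close> without prescribing a moment for constants. For \<open>W = 0\<close> domination
  makes the functional vanish, in accordance with the zero density.\<close>

lemma representing_measure_exists:
  assumes \<Omega>: "convex \<Omega>" "compact \<Omega>" "\<Omega> \<noteq> {}" and "W \<ge> 0"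
    and W: "\<And>u. u \<in> C1_compact \<Longrightarrow> (\<And>x. norm (gradient u x) \<le> 1) \<Longrightarrow> C1_extension f u \<le> W"
  obtains \<sigma> where "\<sigma> \<in> representing_measures \<Omega> f" "total_variation \<sigma> = W"
proof -
  define K :: "((real^'n) \<times> (real^'n)) set" where "K = \<Omega> \<times> sphere 0 1"
  \<comment> \<open>Different \<open>\<phi>\<close> may induce integrands that agree on
    \<open>K\<close>. A relation postpones well-definedness, which domination settles.\<close>
  define P where "P = {(\<lambda>z. gradient \<phi> (fst z) \<bullet> snd z, C1_extension f \<phi>) | \<phi>. \<phi> \<in> C1_compact}"
  have "axis undefined 1 \<in> (sphere 0 1 :: (real^'n) set)" by (simp add: norm_axis_1)
  then have K: "compact K" "K \<noteq> {}"
    using \<Omega> by (auto simp: K_def intro!: compact_Times)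
  obtain M where M: "prob_space M" "sets M = sets (restrict_space borel K)"
    "\<And>g l. (g, l) \<in> P \<Longrightarrow> W * integral\<^sup>L M g = l"
  proof (rule dominated_functional_measure[OF K, of P W])
    show "continuous_on K g" if "(g, l) \<in> P" for g l
      using that unfolding P_def
      by (auto intro!: continuous_intros continuous_on_compose2[OF C1_compactD(4)])
    show "(\<lambda>_. 0, 0) \<in> P"
      unfolding P_def using test_functions_C1_compact[OF zero_test_function]
      by (intro CollectI exI[of _ "\<lambda>_. 0"]) (simp add: C1_extension_0)
    show "(\<lambda>x. a * g x + h x, a * l + m) \<in> P" if gl: "(g, l) \<in> P" and hm: "(h, m) \<in> P" for a g l h m
    proof -
      obtain \<phi> \<psi> where \<phi>: "\<phi> \<in> C1_compact" "g = (\<lambda>z. gradient \<phi> (fst z) \<bullet> snd z)" "l = C1_extension f \<phi>"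
        and \<psi>: "\<psi> \<in> C1_compact" "h = (\<lambda>z. gradient \<psi> (fst z) \<bullet> snd z)" "m = C1_extension f \<psi>"
        using gl hm unfolding P_def by blast
      let ?\<eta> = "\<lambda>x. a * \<phi> x + 1 * \<psi> x"
      have "(\<lambda>x. a * g x + h x, a * l + m) = (\<lambda>z. gradient ?\<eta> (fst z) \<bullet> snd z, C1_extension f ?\<eta>)"
        unfolding C1_extension_linear[OF \<phi>(1) \<psi>(1)]
          gradient_linear_combination[OF C1_compactD(1)[OF \<phi>(1)] C1_compactD(1)[OF \<psi>(1)]] \<phi>(2,3) \<psi>(2,3)
        by (simp add: inner_add_left)
      moreover have "?\<eta> \<in> C1_compact" using \<phi>(1) \<psi>(1) by (rule C1_compact_linear_combination)
      ultimately show ?thesis unfolding P_def by blast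
    qed
    show "l \<le> W * B" if gl: "(g, l) \<in> P" and le: "\<And>z. z \<in> K \<Longrightarrow> g z \<le> B" for g l B
    proof -
      obtain \<phi> where \<phi>: "\<phi> \<in> C1_compact" "g = (\<lambda>z. gradient \<phi> (fst z) \<bullet> snd z)" "l = C1_extension f \<phi>"
        using gl unfolding P_def by blast
      have B: "norm (gradient \<phi> x) \<le> B" if "x \<in> \<Omega>" for x
        using le[of "(x, _)"] that by (intro norm_le_of_inner_sphere) (auto simp: K_def \<phi>(2))
      moreover have "B \<ge> 0" using \<Omega>(3) B norm_ge_zero order_trans by blast
      ultimately show ?thesis
        unfolding \<phi>(3) using C1_extension_le_dual_norm[OF \<Omega> \<phi>(1) _ _ W] by blast
    qed
  qed (rule that)
  interpret M: prob_space M by (rule M(1))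
  have space_M: "space M = K"
    using sets_eq_imp_space_eq[OF M(2)] by (simp add: space_restrict_space)
  define Z :: "((real^'n) \<times> (real^'n) \<times> real) set" where "Z = \<Omega> \<times> sphere 0 1 \<times> {0..}"
  define j where "j z = (fst z, snd z, 0 :: real)" for z :: "(real^'n) \<times> (real^'n)"
  have "j \<in> borel_measurable borel"
    unfolding j_def by (intro borel_measurable_continuous_onI continuous_intros)
  then have "j \<in> borel_measurable M"
    using measurable_restrict_space1 measurable_cong_sets[OF M(2) refl] by blast
  then have j [measurable]: "j \<in> measurable M (restrict_space borel Z)"
    by (intro measurable_restrict_space2) (auto simp: space_M K_def j_def Z_def)
  define N where "N = distr M (restrict_space borel Z) j"
  interpret N: prob_space N
    unfolding N_def by (rule M.prob_space_distr) (rule j)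
  define \<sigma> where "\<sigma> = density N (\<lambda>_. ennreal W)"
  have em: "emeasure \<sigma> (space \<sigma>) = ennreal W"
    unfolding \<sigma>_def by (simp add: emeasure_density_const N.emeasure_space_1)
  have "\<sigma> \<in> pos_finite_measures \<Omega>"
    using em unfolding pos_finite_measures_def
    by (auto intro!: finite_measureI simp: \<sigma>_def N_def Z_def)
  moreover have "(\<integral>z. diff_quot \<phi> z \<partial>\<sigma>) = C1_extension f \<phi>" if \<phi>: "\<phi> \<in> C1_compact" for \<phi>
  proof -
    have [measurable]: "diff_quot \<phi> \<in> borel_measurable (restrict_space borel Z)"
      using diff_quot_measurable[OF \<phi>] by (rule measurable_restrict_space1)
    then have "diff_quot \<phi> \<in> borel_measurable N"
      by (simp add: N_def)
    then have "(\<integral>z. diff_quot \<phi> z \<partial>\<sigma>) = (\<integral>z. W * diff_quot \<phi> z \<partial>N)"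
      unfolding \<sigma>_def using \<open>W \<ge> 0\<close> by (subst integral_density) auto
    also have "\<dots> = W * (\<integral>z. diff_quot \<phi> (j z) \<partial>M)"
      unfolding N_def by (simp add: integral_distr)
    also have "(\<lambda>z. diff_quot \<phi> (j z)) = (\<lambda>z. gradient \<phi> (fst z) \<bullet> snd z)"
      by (simp add: j_def diff_quot_def frechet_derivative_eq_gradient[OF C1_compactD(1)[OF \<phi>]])
    also have "W * (\<integral>z. gradient \<phi> (fst z) \<bullet> snd z \<partial>M) = C1_extension f \<phi>"
      by (rule M(3)) (use \<phi> in \<open>auto simp: P_def\<close>)
    finally show ?thesis .
  qed
  ultimately have "\<sigma> \<in> representing_measures \<Omega> f"
    by (simp add: representing_measures_def)
  moreover have "total_variation \<sigma> = W"
    unfolding total_variation_def measure_def em using \<open>W \<ge> 0\<close> by simp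
  ultimately show thesis by (rule that)
qed

end

theorem theorem3p8:
  fixes \<Omega> :: "(real^'n) set" and f :: "(real^'n \<Rightarrow> real) \<Rightarrow> real"
  assumes "convex \<Omega>" and "compact \<Omega>" and "f \<in> X0 \<Omega>"
  shows "\<exists>\<sigma>\<in>representing_measures \<Omega> f.
           (\<forall>\<tau>\<in>representing_measures \<Omega> f. total_variation \<sigma> \<le> total_variation \<tau>) \<and>
           ereal (total_variation \<sigma>) = W1 f"
proof -
  obtain C where "gradient_bounded_functional \<Omega> f C"
    using X0_gradient_bounded[OF assms] .
  then interpret gradient_bounded_functional \<Omega> f C .
  obtain W where W: "W1 f = ereal W" "W \<ge> 0"
    "\<And>u. u \<in> C1_compact \<Longrightarrow> (\<And>x. norm (gradient u x) \<le> 1) \<Longrightarrow> C1_extension f u \<le> W"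
    using W1_finite by blast
  \<comment> \<open>Only \<open>\<le>\<close> is claimed, since the converse holds for every
    representing measure. This also treats empty \<Omega> without computing
    \<open>W\<close>.\<close>
  have "\<exists>\<sigma>\<in>representing_measures \<Omega> f. total_variation \<sigma> \<le> W"
  proof (cases "\<Omega> = {}")
    case True
    define \<sigma> :: "((real^'n) \<times> (real^'n) \<times> real) measure" 
      where "\<sigma> = null_measure (restrict_space borel (\<Omega> \<times> sphere 0 1 \<times> {0..}))"
    have sp: "space \<sigma> = {}" by (simp add: \<sigma>_def True space_restrict_space)
    \<comment> \<open>On empty \<Omega> every gradient is vacuously bounded by 0.\<close>
    have "C1_extension f \<phi> = 0" if "\<phi> \<in> C1_compact" for \<phi>
      using C1_extension_bound[OF that, of 0] True by simp
    moreover have "(\<integral>z. diff_quot \<phi> z \<partial>\<sigma>) = 0" for \<phi>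
      by (subst Bochner_Integration.integral_cong[where g="\<lambda>_. 0"]) (auto simp: sp)
    ultimately have "\<sigma> \<in> representing_measures \<Omega> f"
      by (auto simp: representing_measures_def pos_finite_measures_def sp intro!: finite_measureI) (simp add: \<sigma>_def)+
    moreover have "total_variation \<sigma> \<le> W" using W(2) by (simp add: total_variation_def sp)
    ultimately show ?thesis by blast
  next
    case False
    then show ?thesis
      using representing_measure_exists[OF assms(1,2) False W(2,3)] by (metis order_refl)
  qed
  then obtain \<sigma> where \<sigma>: "\<sigma> \<in> representing_measures \<Omega> f" "total_variation \<sigma> \<le> W" by blast
  have le: "W \<le> total_variation \<tau>" if "\<tau> \<in> representing_measures \<Omega> f" for \<tau>
    using W1_le_total_variation[OF that] by (simp add: W(1))
  show ?thesis
  proof (intro bexI[of _ \<sigma>] conjI ballI \<sigma>(1))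
    show "total_variation \<sigma> \<le> total_variation \<tau>" if "\<tau> \<in> representing_measures \<Omega> f" for \<tau>
      using le[OF that] \<sigma>(2) by linarith
    show "ereal (total_variation \<sigma>) = W1 f"
      using le[OF \<sigma>(1)] \<sigma>(2) by (simp add: W(1))
  qed
qed

end
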